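(* Let $\mathcal C$ be an $E$-cusp, where $E$ is the last divisor of a cuspidal sequence of blowing-ups $\mathcal S$ with Puiseux pair $(n,m)$, $n\ge 2$, and let $(x,y)$ be local coordinates adapted to $\mathcal S$. Let $\Gamma=n\mathbb Z_{\ge 0}+m\mathbb Z_{\ge 0}$, let $(\lambda_{-1},\lambda_0,\lambda_1,\ldots,\lambda_s)$, with $\lambda_{-1}=n,\lambda_0=m$, be the basis of the semimodule of differential values $\Lambda^{\mathcal C}=\bigcup_{j=-1}^{s}(\lambda_j+\Gamma)$ of $\mathcal C$, and consider an extended standard basis $$\omega_{-1}=dx,\ \omega_0=dy,\ \omega_1,\ldots,\omega_{s+1}$$ of $\mathcal C$. Take an index $i\in\{1,2,\ldots,s+1\}$, a free point $P\in E$, and let $\mathcal C^i_P$ be the analytic semiroot of $\mathcal C$ through $P$ defined by $\omega_i$. Then the semimodule of differential values of $\mathcal C^i_P$ is precisely $\Lambda^{\mathcal C}_{i-1}=\bigcup_{j=-1}^{i-1}(\lambda_j+\Gamma)$, and $$\omega_{-1}=dx,\ \omega_0=dy,\ \omega_1,\ldots,\omega_i$$ is an extended standard basis for $\mathcal C^i_P$.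
   Context: **Cuspidal sequences.** $(M_0,P_0)$ is a two-dimensional germ of nonsingular complex analytic space. Consider a sequence $\mathcal S$ of $N\ge 1$ blowing-ups $\pi_k:(M_k,K_k)\to(M_{k-1},K_{k-1})$, $k=1,\ldots,N$, with $K_0=\{P_0\}$, where $\pi_k$ is centered at a point $P_{k-1}\in K_{k-1}$. Put $E^k_k=\pi_k^{-1}(P_{k-1})$, and for $j<k$ let $E^k_j\subset M_k$ be the strict transform of $E^{k-1}_j$; then $K_k=E^k_1\cup\cdots\cup E^k_k$ is the preimage of $P_0$. For $P\in K_k$ let $e(P)=\#\{j: P\in E^k_j\}\in\{1,2\}$; $P$ is free if $e(P)=1$ and a corner if $e(P)=2$. $\mathcal S$ is cuspidal if $P_k\in E^k_k$ for $1\le k\le N-1$ and $e(P_{k-1})\le e(P_k)$ for $2\le k\le N-1$. Write $M=M_N$, $K=K_N$, $\pi=\pi_1\circ\cdots\circ\pi_N:(M,K)\to(M_0,P_0)$, and $E=E^N_N$ (the last divisor). The index of freeness $f$ is $0$ if $N=1$; if $N\ge2$, $1\le f\le N-1$ is such that $P_1,\ldots,P_f$ are free and $P_{f+1},\ldots,P_{N-1}$ are corners. The Puiseux pair $(n,m)$ of $\mathcal S$ is $(1,1)$ if $N=1$; if $N\ge2$ and $(n_1,m_1)$ is the Puiseux pair of the cuspidal sequence $\mathcal S^{(1)}$ of length $N-1$ starting at $(M_1,P_1)$ obtained by restricting $\pi_2,\ldots,\pi_N$, then $(n,m)=(n_1,m_1+n_1)$ if $f\ge2$ and $(n,m)=(m_1,n_1+m_1)$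 if $f=1$. Local coordinates $(x,y)$ at $P_0$ are adapted to $\mathcal S$ if, for each $1\le k\le f$, $P_k$ is an infinitely near point of the curve $y=0$ (lies on its strict transform). **Cusps and differential values.** An $E$-cusp is an analytic branch $(\mathcal C,P_0)\subset(M_0,P_0)$ whose strict transform by $\pi$ is nonsingular and cuts $E$ transversely at a free point. If $\phi(t)$ is a reduced (Puiseux) parametrization of $\mathcal C$ and $\omega$ is a germ at $P_0$ of holomorphic $1$-form, write $\phi^*\omega=a(t)\,dt/t$ and put $\nu_{\mathcal C}(\omega)=\operatorname{order}_t(a(t))$ ($=\infty$ when $\phi^*\omega=0$, i.e. when $\mathcal C$ is an invariant branch of $\omega$). The semimodule of differential values is $\Lambda^{\mathcal C}=\{\nu_{\mathcal C}(\omega):\omega\in\Omega^1_{M_0,P_0}\}\setminus\{\infty\}$. It satisfies $\Lambda^{\mathcal C}+\Gamma\subset\Lambda^{\mathcal C}$. Its basis is the unique strictly increasing finite sequence $(\lambda_{-1},\ldots,\lambda_s)$ with $\Lambda^{\mathcal C}=\bigcup_{j=-1}^s(\lambda_j+\Gamma)$ and $\lambda_j\notin\bigcup_{l<j}(\lambda_l+\Gamma)$ for $0\le j\le s$; one has $\lambda_{-1}=n,\lambda_0=m$. Put $\Lambda_i=\Lambda^{\mathcal C}_i=\bigcup_{j=-1}^{i}(\lambda_j+\Gamma)$. **Axes, critical orders.** $u_0=\lambda_{-1}$ and $u_i=\min(\Lambda_{i-2}\cap(\lambda_{i-1}+\Gamma))$ for $1\le i\le s+1$; $t_{-1}=n$,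 $t_0=m$, $t_i=t_{i-1}+u_i-\lambda_{i-1}$ for $1\le i\le s+1$. **Divisorial order.** In adapted coordinates, for $h=\sum h_{\alpha\beta}x^\alpha y^\beta$, $\nu_E(h)=\min\{n\alpha+m\beta: h_{\alpha\beta}\ne0\}$, and $\nu_E(a\,dx+b\,dy)=\min\{\nu_E(xa),\nu_E(yb)\}$. **Extended standard basis.** For an $E$-cusp $\mathcal C$ with basis of differential values $(\lambda_{-1},\ldots,\lambda_s)$, it is a list $\omega_{-1}=dx,\omega_0=dy,\omega_1,\ldots,\omega_s,\omega_{s+1}$ of germs of holomorphic $1$-forms with $\nu_{\mathcal C}(\omega_j)=\lambda_j$ for $-1\le j\le s$, $\nu_E(\omega_{s+1})=t_{s+1}$ and $\nu_{\mathcal C}(\omega_{s+1})=\infty$. **Analytic semiroots.** For $1\le i\le s+1$ the foliation defined by $\pi^*\omega_i$ (after removing common factors) is nonsingular at the points of $E$, transversal to $E$, and has normal crossings with $K$. For a free point $P\in E$, $\mathcal C^i_P$ is the $E$-cusp invariant by $\omega_i$ whose strict transform by $\pi$ passes through $P$ (the image by $\pi$ of the leaf through $P$). *)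

theory Defs
  imports "HOL-Analysis.Analysis" "HOL-Library.Sublist"
begin

text \<open>
  A choice of local coordinates \<open>(x, y)\<close> identifies \<open>(M\<^sub>0, P\<^sub>0)\<close> with the germ of the plane \<open>\<complex>\<^sup>2\<close>
  at the origin. Germs of holomorphic functions are convergent power series; a series in two
  variables is an element \<open>h\<close> of \<open>complex fps fps\<close>, the coefficient of \<open>x\<^sup>\<alpha> y\<^sup>\<beta>\<close> being
  \<open>fps_nth (fps_nth h \<alpha>) \<beta>\<close> (the outer variable is \<open>x\<close>, the inner one is \<open>y\<close>).
\<close>

type_synonym series2 = "complex fps fps"

definition coeff2 :: "series2 \<Rightarrow> nat \<Rightarrow> nat \<Rightarrow> complex" where
  "coeff2 h \<alpha> \<beta> = fps_nth (fps_nth h \<alpha>) \<beta>"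

definition coord_x :: series2 where "coord_x = fps_X"
definition coord_y :: series2 where "coord_y = fps_const fps_X"

definition holomorphic_germ :: "series2 \<Rightarrow> bool" where
  "holomorphic_germ h \<longleftrightarrow>
     (\<exists>r>0. (\<lambda>(\<alpha>, \<beta>). norm (coeff2 h \<alpha> \<beta>) * r ^ (\<alpha> + \<beta>)) summable_on (UNIV :: (nat \<times> nat) set))"

text \<open>The pair \<open>(a, b)\<close> stands for the 1-form \<open>a dx + b dy\<close>.\<close>

type_synonym form = "series2 \<times> series2"

definition holomorphic_form :: "form \<Rightarrow> bool" where
  "holomorphic_form \<omega> \<longleftrightarrow> holomorphic_germ (fst \<omega>) \<and> holomorphic_germ (snd \<omega>)"

definition form_dx :: form where "form_dx = (1, 0)"
definition form_dy :: form where "form_dy = (0, 1)"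


subsection \<open>Branches\<close>

text \<open>
  A parametrized curve germ \<open>t \<mapsto> (u(t), v(t))\<close> in given local coordinates. An analytic branch is
  represented by any of its reduced parametrizations, where reduced (primitive) means that the
  parametrization does not factor through a map \<open>\<tau>\<close> of order at least two.
\<close>

type_synonym param = "complex fps \<times> complex fps"

definition centred :: "param \<Rightarrow> bool" where
  "centred \<phi> \<longleftrightarrow> fps_nth (fst \<phi>) 0 = 0 \<and> fps_nth (snd \<phi>) 0 = 0"

definition reduced_param :: "param \<Rightarrow> bool" where
  "reduced_param \<phi> \<longleftrightarrow>
     (\<forall>\<psi>\<^sub>1 \<psi>\<^sub>2 \<tau>. fps_nth \<tau> 0 = 0 \<and> fst \<phi> = fps_compose \<psi>\<^sub>1 \<tau> \<and> snd \<phi> = fps_compose \<psi>\<^sub>2 \<tau>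
        \<longrightarrow> subdegree \<tau> = 1)"

definition branch :: "param \<Rightarrow> bool" where
  "branch \<phi> \<longleftrightarrow> fps_conv_radius (fst \<phi>) > 0 \<and> fps_conv_radius (snd \<phi>) > 0 \<and>
     centred \<phi> \<and> \<phi> \<noteq> (0, 0) \<and> reduced_param \<phi>"


subsection \<open>Infinitely near points and sequences of blowing-ups\<close>

text \<open>
  A point of the exceptional divisor of the blowing-up of a point with local coordinates \<open>(x, y)\<close> is
  a direction \<open>[1 : c]\<close> (\<open>Slope c\<close>) or \<open>[0 : 1]\<close> (\<open>Vertical\<close>). It has centred coordinates \<open>(u, v)\<close>
  with \<open>(x, y) = (u, u (v + c))\<close>, respectively \<open>(x, y) = (u v, v)\<close>; in them the exceptional divisor
  is \<open>u = 0\<close>, respectively \<open>v = 0\<close>, and \<open>exceptional_param\<close> parametrizes it.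
\<close>

datatype direction = Slope complex | Vertical

fun blow_down :: "direction \<Rightarrow> param \<Rightarrow> param" where
  "blow_down (Slope c) (u, v) = (u, u * (v + fps_const c))"
| "blow_down Vertical (u, v) = (u * v, v)"

fun exceptional_param :: "direction \<Rightarrow> param" where
  "exceptional_param (Slope c) = (0, fps_X)"
| "exceptional_param Vertical = (fps_X, 0)"

text \<open>
  An infinitely near point is the list of the directions leading to it, the first blowing-up coming
  first; the empty list is the initial point.
\<close>

type_synonym inpoint = "direction list"

primrec blow_down_path :: "inpoint \<Rightarrow> param \<Rightarrow> param" where
  "blow_down_path [] \<psi> = \<psi>"
| "blow_down_path (d # p) \<psi> = blow_down d (blow_down_path p \<psi>)"

text \<open>
  The strict transform of the curve \<open>\<phi>\<close> passes through \<open>p\<close> and is \<open>\<psi>\<close> in the coordinates at \<open>p\<close>.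
  For nonzero \<open>\<phi>\<close> such a lift \<open>\<psi>\<close> is unique; it is not contained in the exceptional divisor, which
  is mapped to the base point.
\<close>

definition strict_transform_at :: "inpoint \<Rightarrow> param \<Rightarrow> param \<Rightarrow> bool" where
  "strict_transform_at p \<phi> \<psi> \<longleftrightarrow> centred \<psi> \<and> blow_down_path p \<psi> = \<phi>"

definition infinitely_near_point_of :: "inpoint \<Rightarrow> param \<Rightarrow> bool" where
  "infinitely_near_point_of p \<phi> \<longleftrightarrow> (\<exists>\<psi>. strict_transform_at p \<phi> \<psi>)"

text \<open>
  A sequence of \<open>N\<close> blowing-ups is the list \<open>[P\<^sub>0, \<dots>, P\<^bsub>N-1\<^esub>]\<close> of its centres, so that \<open>take k cs\<close>
  describes \<open>M\<^sub>k\<close>. A point of \<open>K\<^sub>k\<close> is an infinitely near point which has not been blown up, while all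
  the points below it have been.
\<close>

definition exceptional_points :: "inpoint list \<Rightarrow> inpoint set" where
  "exceptional_points cs = {p. p \<notin> set cs \<and> (\<forall>q. strict_prefix q p \<longrightarrow> q \<in> set cs)}"

definition blowup_sequence :: "inpoint list \<Rightarrow> bool" where
  "blowup_sequence cs \<longleftrightarrow>
     cs \<noteq> [] \<and> (\<forall>k<length cs. cs ! k \<in> exceptional_points (take k cs))"

text \<open>
  With \<open>k = length cs\<close>, \<open>divisor cs j\<close> is \<open>E\<^sup>k\<^sub>j\<close> for \<open>1 \<le> j \<le> k\<close>: a point of it lies above
  a point \<open>P\<^bsub>j-1\<^esub> @ [d]\<close> of \<open>E\<^sup>j\<^sub>j\<close> (is that point itself if \<open>p = []\<close> below), and is on the strict
  transform of \<open>E\<^sup>j\<^sub>j\<close>.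
\<close>

definition divisor :: "inpoint list \<Rightarrow> nat \<Rightarrow> inpoint set" where
  "divisor cs j = {q \<in> exceptional_points cs.
     \<exists>d p. q = cs ! (j - 1) @ d # p \<and> infinitely_near_point_of p (exceptional_param d)}"

definition e_number :: "inpoint list \<Rightarrow> inpoint \<Rightarrow> nat" where
  "e_number cs p = card {j \<in> {1..length cs}. p \<in> divisor cs j}"

definition free_point :: "inpoint list \<Rightarrow> inpoint \<Rightarrow> bool" where
  "free_point cs p \<longleftrightarrow> p \<in> exceptional_points cs \<and> e_number cs p = 1"

definition corner_point :: "inpoint list \<Rightarrow> inpoint \<Rightarrow> bool" where
  "corner_point cs p \<longleftrightarrow> p \<in> exceptional_points cs \<and> e_number cs p = 2"

definition cuspidal :: "inpoint list \<Rightarrow> bool" where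
  "cuspidal cs \<longleftrightarrow> blowup_sequence cs \<and>
     (\<forall>k. 1 \<le> k \<and> k \<le> length cs - 1 \<longrightarrow> cs ! k \<in> divisor (take k cs) k) \<and>
     (\<forall>k. 2 \<le> k \<and> k \<le> length cs - 1 \<longrightarrow>
        e_number (take (k - 1) cs) (cs ! (k - 1)) \<le> e_number (take k cs) (cs ! k))"

definition freeness_index :: "inpoint list \<Rightarrow> nat" where
  "freeness_index cs =
     (if length cs \<le> 1 then 0
      else (THE f. 1 \<le> f \<and> f \<le> length cs - 1 \<and>
              (\<forall>k. 1 \<le> k \<and> k \<le> f \<longrightarrow> free_point (take k cs) (cs ! k)) \<and>
              (\<forall>k. f + 1 \<le> k \<and> k \<le> length cs - 1 \<longrightarrow> corner_point (take k cs) (cs ! k))))"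

text \<open>
  The sequence starting at \<open>(M\<^sub>1, P\<^sub>1)\<close>: all centres \<open>P\<^sub>k\<close> with \<open>k \<ge> 1\<close> of a cuspidal sequence lie above
  \<open>P\<^sub>1\<close>, so their lists of directions relative to \<open>P\<^sub>1\<close> are obtained by dropping the first entry.
\<close>

definition derived_sequence :: "inpoint list \<Rightarrow> inpoint list" where
  "derived_sequence cs = map tl (tl cs)"

function puiseux_pair :: "inpoint list \<Rightarrow> nat \<times> nat" where
  "puiseux_pair cs =
     (if length cs \<le> 1 then (1, 1)
      else let (n\<^sub>1, m\<^sub>1) = puiseux_pair (derived_sequence cs)
           in if freeness_index cs \<ge> 2 then (n\<^sub>1, m\<^sub>1 + n\<^sub>1) else (m\<^sub>1, n\<^sub>1 + m\<^sub>1))"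
  by pat_completeness auto
termination
  by (relation "Wellfounded.measure length") (auto simp: derived_sequence_def)

declare puiseux_pair.simps [simp del]

text \<open>The curve \<open>y = 0\<close> is parametrized by \<open>t \<mapsto> (t, 0)\<close>.\<close>

definition adapted_coordinates :: "inpoint list \<Rightarrow> bool" where
  "adapted_coordinates cs \<longleftrightarrow>
     (\<forall>k. 1 \<le> k \<and> k \<le> freeness_index cs \<longrightarrow> infinitely_near_point_of (cs ! k) (fps_X, 0))"


subsection \<open>Cusps and differential values\<close>

definition velocity :: "param \<Rightarrow> complex \<times> complex" where
  "velocity \<phi> = (fps_nth (fst \<phi>) 1, fps_nth (snd \<phi>) 1)"

definition nonsingular_param :: "param \<Rightarrow> bool" where
  "nonsingular_param \<phi> \<longleftrightarrow> velocity \<phi> \<noteq> (0, 0)"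

definition transversal_params :: "param \<Rightarrow> param \<Rightarrow> bool" where
  "transversal_params \<phi> \<psi> \<longleftrightarrow>
     fst (velocity \<phi>) * snd (velocity \<psi>) \<noteq> snd (velocity \<phi>) * fst (velocity \<psi>)"

text \<open>
  The branch \<open>\<phi>\<close> is an \<open>E\<close>-cusp whose strict transform passes through the free point \<open>p\<close> of the last
  divisor \<open>E\<close>. Near \<open>p\<close>, \<open>E\<close> is the exceptional divisor of the last direction of \<open>p\<close>.
\<close>

definition E_cusp_through :: "inpoint list \<Rightarrow> inpoint \<Rightarrow> param \<Rightarrow> bool" where
  "E_cusp_through cs p \<phi> \<longleftrightarrow> branch \<phi> \<and> p \<in> divisor cs (length cs) \<and> free_point cs p \<and>
     (\<exists>\<psi>. strict_transform_at p \<phi> \<psi> \<and> nonsingular_param \<psi> \<and>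
          transversal_params \<psi> (exceptional_param (last p)))"

definition E_cusp :: "inpoint list \<Rightarrow> param \<Rightarrow> bool" where
  "E_cusp cs \<phi> \<longleftrightarrow> (\<exists>p. E_cusp_through cs p \<phi>)"

text \<open>
  The series \<open>h(x(t), y(t))\<close>, for \<open>(x, y)\<close> centred: as \<open>x\<^sup>\<alpha> y\<^sup>\<beta>\<close> has order at least \<open>\<alpha> + \<beta>\<close>, only the
  terms with \<open>\<alpha>, \<beta> \<le> k\<close> contribute to the coefficient of \<open>t\<^sup>k\<close>.
\<close>

definition restrict_to :: "param \<Rightarrow> series2 \<Rightarrow> complex fps" where
  "restrict_to \<phi> h =
     Abs_fps (\<lambda>k. \<Sum>\<alpha>\<le>k. \<Sum>\<beta>\<le>k. coeff2 h \<alpha> \<beta> * fps_nth (fst \<phi> ^ \<alpha> * snd \<phi> ^ \<beta>) k)"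

text \<open>The series \<open>a(t)\<close> such that the pull-back of the form by \<open>\<phi>\<close> is \<open>a(t) dt / t\<close>.\<close>

definition log_pullback :: "param \<Rightarrow> form \<Rightarrow> complex fps" where
  "log_pullback \<phi> \<omega> =
     fps_X * (restrict_to \<phi> (fst \<omega>) * fps_deriv (fst \<phi>) + restrict_to \<phi> (snd \<omega>) * fps_deriv (snd \<phi>))"

definition fps_order :: "complex fps \<Rightarrow> enat" where
  "fps_order a = (if a = 0 then \<infinity> else enat (subdegree a))"

definition diff_value :: "param \<Rightarrow> form \<Rightarrow> enat" where
  "diff_value \<phi> \<omega> = fps_order (log_pullback \<phi> \<omega>)"

definition diff_values :: "param \<Rightarrow> nat set" where
  "diff_values \<phi> = {k. \<exists>\<omega>. holomorphic_form \<omega> \<and> diff_value \<phi> \<omega> = enat k}"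

definition Gamma :: "nat \<Rightarrow> nat \<Rightarrow> nat set" where
  "Gamma n m = {n * a + m * b | a b. True}"

definition shifted_Gamma :: "nat \<Rightarrow> nat \<Rightarrow> nat \<Rightarrow> nat set" where
  "shifted_Gamma n m l = (\<lambda>g. l + g) ` Gamma n m"

text \<open>
  Sequences indexed by \<open>-1, 0, \<dots>, s\<close> are functions on \<open>int\<close>, whose values outside of that range are
  irrelevant.
\<close>

definition Lambda_upto :: "nat \<Rightarrow> nat \<Rightarrow> (int \<Rightarrow> nat) \<Rightarrow> int \<Rightarrow> nat set" where
  "Lambda_upto n m lam i = (\<Union>j\<in>{-1..i}. shifted_Gamma n m (lam j))"

definition semimodule_basis ::
    "nat \<Rightarrow> nat \<Rightarrow> nat set \<Rightarrow> (int \<Rightarrow> nat) \<Rightarrow> int \<Rightarrow> bool" where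
  "semimodule_basis n m L lam s \<longleftrightarrow> -1 \<le> s \<and> strict_mono_on {-1..s} lam \<and>
     L = Lambda_upto n m lam s \<and> (\<forall>j\<in>{0..s}. lam j \<notin> Lambda_upto n m lam (j - 1))"

definition axis :: "nat \<Rightarrow> nat \<Rightarrow> (int \<Rightarrow> nat) \<Rightarrow> int \<Rightarrow> nat" where
  "axis n m lam i =
     (if i \<le> 0 then lam (-1)
      else Inf (Lambda_upto n m lam (i - 2) \<inter> shifted_Gamma n m (lam (i - 1))))"

text \<open>The subtraction does not truncate, since \<open>u\<^sub>i \<ge> \<lambda>\<^bsub>i-1\<^esub>\<close>.\<close>

function critical_order :: "nat \<Rightarrow> nat \<Rightarrow> (int \<Rightarrow> nat) \<Rightarrow> int \<Rightarrow> nat" where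
  "critical_order n m lam i =
     (if i \<le> -1 then n else if i = 0 then m
      else critical_order n m lam (i - 1) + axis n m lam i - lam (i - 1))"
  by pat_completeness auto
termination
  by (relation "Wellfounded.measure (\<lambda>(n, m, lam, i). nat i)") auto

declare critical_order.simps [simp del]

definition nu_E :: "nat \<Rightarrow> nat \<Rightarrow> series2 \<Rightarrow> enat" where
  "nu_E n m h = Inf {enat (n * \<alpha> + m * \<beta>) | \<alpha> \<beta>. coeff2 h \<alpha> \<beta> \<noteq> 0}"

definition nu_E_form :: "nat \<Rightarrow> nat \<Rightarrow> form \<Rightarrow> enat" where
  "nu_E_form n m \<omega> = min (nu_E n m (coord_x * fst \<omega>)) (nu_E n m (coord_y * snd \<omega>))"

definition extended_standard_basis ::
    "nat \<Rightarrow> nat \<Rightarrow> param \<Rightarrow> (int \<Rightarrow> nat) \<Rightarrow> int \<Rightarrow> (int \<Rightarrow> form) \<Rightarrow> bool" where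
  "extended_standard_basis n m \<phi> lam s \<omega> \<longleftrightarrow>
     semimodule_basis n m (diff_values \<phi>) lam s \<and>
     (\<forall>j\<in>{-1..s+1}. holomorphic_form (\<omega> j)) \<and>
     \<omega> (-1) = form_dx \<and> \<omega> 0 = form_dy \<and>
     (\<forall>j\<in>{-1..s}. diff_value \<phi> (\<omega> j) = enat (lam j)) \<and>
     nu_E_form n m (\<omega> (s + 1)) = enat (critical_order n m lam (s + 1)) \<and>
     diff_value \<phi> (\<omega> (s + 1)) = \<infinity>"

text \<open>The \<open>E\<close>-cusp through \<open>p\<close> which is an invariant branch of \<open>\<omega>\<close>.\<close>

definition analytic_semiroot :: "inpoint list \<Rightarrow> form \<Rightarrow> inpoint \<Rightarrow> param \<Rightarrow> bool" where
  "analytic_semiroot cs \<omega> p \<phi> \<longleftrightarrow> E_cusp_through cs p \<phi> \<and> diff_value \<phi> \<omega> = \<infinity>"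

end

theory Submission
  imports Defs "HOL-Number_Theory.Cong"
begin

text \<open>
  In adapted coordinates all centres of the cuspidal sequence are origins of charts, so every
  \<open>E\<close>-cusp has \<open>x\<close> of order \<open>n\<close> and \<open>y\<close> of order \<open>m\<close>. Values of functions then lie in \<open>\<Gamma>\<close>, and below
  \<open>n m\<close> the value of a function is its weight, whatever the cusp. Everything is read off wedge
  products \<open>\<omega> \<and> \<eta> = h dx \<and> dy\<close>: if \<open>\<omega>\<close> has weight \<open>t < n m\<close> and larger value, then its leading term is
  a multiple of \<open>m dx/x - n dy/y\<close>, and \<open>n + m + \<nu>(h) = t + \<nu>(\<eta>)\<close> as soon as the value of \<open>\<omega>\<close> is large
  enough. Membership of \<open>t + \<nu>(\<eta>) - n - m\<close> in \<open>\<Gamma>\<close> forces the weights of a standard basis to be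
  the critical orders and the basis to be increasing. Finally \<open>\<omega>\<^sub>i \<and> \<omega>\<^sub>j\<close> with \<open>j < i\<close> has value less
  than \<open>n m\<close>, the same on \<open>C\<close> and on the semiroot, which gives \<open>\<nu>(\<omega>\<^sub>j)\<close> on the semiroot; and a value
  \<open>v\<close> of the semiroot outside of \<open>\<Lambda>\<^bsub>i-1\<^esub>\<close> would exceed \<open>u\<^sub>i\<close>, where \<open>v + t\<^sub>i - n - m\<close> is never in \<open>\<Gamma>\<close>.
\<close>

subsection \<open>The semigroup\<close>

text \<open>Eliminating \<open>dy\<close> between the pull-backs of \<omega> and \<eta> writes h
  times a series of order n + m as a difference of two products; this is the origin of the constant
  n + m. If the products have different orders, the order of h is known. Two obstacles shape the
  proof. An extended standard basis prescribes the weight of its last form only, so the weights of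
  the other forms must be recovered from their values before anything can be moved to another cusp.
  And the two products may have equal order, in which case h tells nothing. Such ties are excluded
  by arithmetic: if \<eta> has weight n + m + e, the induction shows that e moves the semimodule of
  the earlier values into \<open>Gamma\<close>, and c = t_l - n - m is the least number in
  \<open>Gamma\<close> that does so. Hence semimodules enter through their duals, and gaps of
  \<open>Gamma\<close> through the coordinates (a, b) in which they are n m - n a - m b. The passage
  from C to another cusp rests on c + u_l <= n m, which keeps the wedge products in the range where
  weight and value agree.\<close>

lemma GammaI: "n * a + m * b \<in> Gamma n m"
  unfolding Gamma_def by blast

lemma Gamma_0: "0 \<in> Gamma n m"
  using GammaI[of n 0 m 0] by simp

lemma Gamma_left: "n * a \<in> Gamma n m" and Gamma_right: "m * b \<in> Gamma n m"
  using GammaI[of n a m 0] GammaI[of n 0 m b] by simp_all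

lemma Gamma_add:
  assumes "g \<in> Gamma n m" "h \<in> Gamma n m"
  shows "g + h \<in> Gamma n m"
proof -
  from assms obtain a b a' b' where "g = n * a + m * b" "h = n * a' + m * b'"
    unfolding Gamma_def by blast
  then have "g + h = n * (a + a') + m * (b + b')" by (simp add: algebra_simps)
  then show ?thesis using GammaI by metis
qed

lemma shifted_Gamma_iff: "v \<in> shifted_Gamma n m l \<longleftrightarrow> (\<exists>g\<in>Gamma n m. v = l + g)"
  unfolding shifted_Gamma_def by blast

text \<open>Modulo n, y is congruent to m b for exactly one b < n. A y outside \<open>Gamma\<close>
  is smaller than this m b, and m b = y + n k gives the pair (k, n - b). Such pairs are the
  coordinates of gaps in all that follows.\<close>

lemma Gamma_gap:
  assumes "coprime n m" "0 < n" "y \<notin> Gamma n m"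
  obtains a b where "1 \<le> a" "1 \<le> b" "y + n * a + m * b = n * m"
proof -
  obtain b0 where "[m * b0 = 1] (mod n)"
    using assms(1) by (metis One_nat_def coprime_commute cong_solve_coprime_nat)
  then have b0: "[m * (b0 * y mod n) = y] (mod n)"
    by (metis cong_def mod_mult_left_eq mod_mult_right_eq mult.assoc mult_1)
  define b where "b = b0 * y mod n"
  have b: "b < n" unfolding b_def using assms(2) by simp
  have b1: "[m * b = y] (mod n)" using b0 b_def by simp
  have "m * b > y"
  proof (rule ccontr)
    assume "\<not> m * b > y"
    then have le: "m * b \<le> y" by simp
    then obtain k where "y = m * b + n * k"
      using b1 by (metis cong_le_nat cong_sym mult.commute add.commute)
    then show False using assms(3) GammaI[of n k m b] by (simp add: add.commute)
  qed
  then obtain k where k: "m * b = y + n * k"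
    using b1 by (metis cong_le_nat less_imp_le mult.commute add.commute)
  then have "k \<ge> 1" using \<open>m * b > y\<close> by (cases k) auto
  moreover have "y + n * k + m * (n - b) = n * m"
    unfolding k[symmetric] using b by (simp add: algebra_simps flip: distrib_left)
  ultimately show ?thesis using that[of k "n - b"] b by simp
qed

lemma Gamma_ge:
  assumes "coprime n m" "0 < n" "n * m \<le> y"
  shows "y \<in> Gamma n m"
proof (rule ccontr)
  assume "y \<notin> Gamma n m"
  then obtain a b where "1 \<le> a" "1 \<le> b" "y + n * a + m * b = n * m"
    using Gamma_gap assms by metis
  moreover have "n * a > 0" using assms(2) \<open>1 \<le> a\<close> by simp
  ultimately show False using assms(3) by linarith
qed

lemma no_positive_relation:
  assumes "coprime n m" "0 < n" "0 < m" "1 \<le> a" "1 \<le> b"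
  shows "n * a + m * b \<noteq> n * (m :: nat)"
proof
  assume h: "n * a + m * b = n * m"
  have "n dvd n * a + m * b" using h by simp
  then have "n dvd m * b" by (metis dvd_add_right_iff dvd_triv_left)
  then have "n dvd b" using assms(1) coprime_dvd_mult_right_iff by blast
  then have "n \<le> b" using assms(5) by (simp add: dvd_imp_le)
  then have "m * b \<ge> n * m" by simp
  moreover have "n * a > 0" using assms by simp
  ultimately show False using h by linarith
qed

text \<open>Adding n a' + m b' moves the coordinates (a, b) of y to (a - a', b - b'), and a number
  with both coordinates positive is a gap by \<open>no_positive_relation\<close>. Once a <= a', the
  identity y + n a = m (n - b) exhibits an element of \<open>Gamma\<close>; likewise for b.\<close>

lemma Gamma_gap_add_iff:
  assumes "coprime n m" "0 < n" "0 < m" "y + n * a + m * b = n * m"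
  shows "y + (n * a' + m * b') \<in> Gamma n m \<longleftrightarrow> a \<le> a' \<or> b \<le> b'"
proof
  assume "a \<le> a' \<or> b \<le> b'"
  then show "y + (n * a' + m * b') \<in> Gamma n m"
  proof
    assume "a \<le> a'"
    then obtain k where k: "a' = a + k" using le_iff_add by blast
    show ?thesis
    proof (cases "b \<le> n")
      case True
      then obtain q where q: "n = b + q" using le_iff_add by blast
      have "m * b + (y + n * a) = m * b + m * q" using assms(4)
        by (metis q add.commute distrib_right mult.commute)
      then have "y + (n * a' + m * b') = n * k + m * (q + b')" unfolding k by (simp add: algebra_simps)
      then show ?thesis using GammaI by metis
    next
      case False
      then have "n * m < m * b" using assms(3) by (simp add: mult.commute)
      then show ?thesis using assms(4) by linarith
    qed
  next
    assume "b \<le> b'"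
    then obtain k where k: "b' = b + k" using le_iff_add by blast
    show ?thesis
    proof (cases "a \<le> m")
      case True
      then obtain q where q: "m = a + q" using le_iff_add by blast
      have "n * a + (y + m * b) = n * a + n * q" using assms(4)
        by (metis q add.commute add.left_commute distrib_left)
      then have "y + (n * a' + m * b') = n * (q + a') + m * k" unfolding k by (simp add: algebra_simps)
      then show ?thesis using GammaI by metis
    next
      case False
      then have "n * m < n * a" using assms(2) by simp
      then show ?thesis using assms(4) by linarith
    qed
  qed
next
  assume "y + (n * a' + m * b') \<in> Gamma n m"
  then obtain c d where cd: "y + (n * a' + m * b') = n * c + m * d" unfolding Gamma_def by blast
  show "a \<le> a' \<or> b \<le> b'"
  proof (rule ccontr)
    assume "\<not> (a \<le> a' \<or> b \<le> b')"
    then obtain p q where p: "a = a' + p" "1 \<le> p" and q: "b = b' + q" "1 \<le> q"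
      by (metis One_nat_def Suc_leI le_add_diff_inverse less_imp_le not_le zero_less_diff)
    have "n * (c + p) + m * (d + q) = n * m"
      using cd assms(4) unfolding p(1) q(1) by (simp add: algebra_simps)
    then show False using no_positive_relation[OF assms(1-3), of "c + p" "d + q"] p(2) q(2) by simp
  qed
qed

lemma weight_unique:
  assumes "coprime n m" "0 < n" "0 < m" "n * a + m * b = n * a' + m * b'" "n * a + m * b < n * m"
  shows "a = a' \<and> b = (b' :: nat)"
proof -
  have *: "x \<le> x'" if "n * x + m * z = n * x' + m * z'" "n * x + m * z < n * m" for x z x' z'
  proof (rule ccontr)
    assume "\<not> x \<le> x'"
    then obtain k where k: "x = x' + k" "1 \<le> k" by (metis One_nat_def Suc_leI le_add_diff_inverse less_imp_le not_le zero_less_diff)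
    have eq: "n * k + m * z = m * z'" using that(1) k(1) by (simp add: algebra_simps)
    have "z < z'" using eq k(2) assms(2,3)
      by (metis add_gr_0 le_add2 mult_le_mono2 nat_0_less_mult_iff not_le not_one_le_zero order_less_le
            add_cancel_left_left mult_is_0)
    then obtain l where l: "z' = z + l" "1 \<le> l"
      by (metis One_nat_def Suc_leI le_add_diff_inverse less_imp_le zero_less_diff)
    have nk: "n * k = m * l" using eq l(1) by (simp add: algebra_simps)
    then have "m dvd k" using assms(1)
      by (metis coprime_commute coprime_dvd_mult_right_iff dvd_triv_left)
    then have "m \<le> k" using k(2) by (simp add: dvd_imp_le)
    then have "n * m \<le> n * x" unfolding k(1) by simp
    then show False using that(2) by linarith
  qed
  have "a = a'" using *[of a b a' b'] *[of a' b' a b] assms(4,5) by simp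
  then show ?thesis using assms(3,4) by simp
qed

subsection \<open>Semimodules\<close>

text \<open>
  Used with \<open>L = \<Lambda>\<^bsub>l-1\<^esub>\<close>, \<open>u = u\<^sub>l\<close> and \<open>c = t\<^sub>l - n - m\<close>. Beyond \<open>u\<close>, \<open>L\<close> is \<open>\<Gamma> - c\<close>. The last
  condition makes \<open>c\<close> the least element of the dual semimodule \<open>{e \<in> \<Gamma>. e + L \<subseteq> \<Gamma>}\<close>, in the form which
  is inherited by the next step: the elements that are not above \<open>c\<close> are at least \<open>n m - u \<ge> c\<close>.
\<close>

definition corner_of :: "nat \<Rightarrow> nat \<Rightarrow> nat set \<Rightarrow> nat \<Rightarrow> nat \<Rightarrow> bool" where
  "corner_of n m L u c \<longleftrightarrow> c + u \<le> n * m \<and>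
     (\<forall>v\<in>L. v + c \<in> Gamma n m) \<and>
     (\<forall>v>u. v + c \<in> Gamma n m \<longrightarrow> v \<in> L) \<and>
     (\<forall>e\<in>Gamma n m. (\<forall>v\<in>L. v + e \<in> Gamma n m) \<longrightarrow> (\<exists>g\<in>Gamma n m. e = c + g) \<or> n * m \<le> e + u)"

text \<open>The coordinates (a, b) of the gap l + c decide everything: adding n a or m b is what
  brings l + c into \<open>Gamma\<close>. The smaller of the two, g, is both the distance from l to
  the new axis and the growth of c.\<close>

lemma corner_of_step_aux:
  assumes nm: "coprime n m" "0 < n" "0 < m"
    and cor: "corner_of n m L u c"
    and lam: "l \<notin> L" "u < l"
    and gap: "l + c + n * a + m * b = n * m" "1 \<le> a" "1 \<le> b"
    and g: "g = min (n * a) (m * b)"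
  shows "corner_of n m (L \<union> shifted_Gamma n m l) (l + g) (c + g)"
proof -
  note J = cor[unfolded corner_of_def, THEN conjunct2, THEN conjunct1, rule_format]
    and I = cor[unfolded corner_of_def, THEN conjunct2, THEN conjunct2, THEN conjunct1, rule_format]
    and K = cor[unfolded corner_of_def, THEN conjunct2, THEN conjunct2, THEN conjunct2, rule_format]
  have iff: "l + c + (n * a' + m * b') \<in> Gamma n m \<longleftrightarrow> a \<le> a' \<or> b \<le> b'" for a' b'
    by (rule Gamma_gap_add_iff[OF nm gap(1)])
  have gG: "g \<in> Gamma n m" using g Gamma_left Gamma_right by (metis min_def)
  have lg: "l + c + g \<in> Gamma n m"
    using iff[of a 0] iff[of 0 b] g by (auto simp: min_def)
  show ?thesis
    unfolding corner_of_def
  proof (intro conjI ballI allI impI)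
    show "c + g + (l + g) \<le> n * m" using gap(1) g by linarith
  next
    fix v assume "v \<in> L \<union> shifted_Gamma n m l"
    then show "v + (c + g) \<in> Gamma n m"
    proof
      assume "v \<in> L"
      then have "v + c + g \<in> Gamma n m" using J Gamma_add gG by blast
      then show ?thesis by (simp add: add.assoc)
    next
      assume "v \<in> shifted_Gamma n m l"
      then obtain h where "h \<in> Gamma n m" "v = l + h" using shifted_Gamma_iff by blast
      then show ?thesis using Gamma_add[OF lg, of h] by (simp add: ac_simps)
    qed
  next
    fix v assume v: "l + g < v" "v + (c + g) \<in> Gamma n m"
    show "v \<in> L \<union> shifted_Gamma n m l"
    proof (cases "v + c \<in> Gamma n m")
      case True
      then show ?thesis using I v lam by simp
    next
      case False
      then obtain a' b' where ab: "1 \<le> a'" "1 \<le> b'" "v + c + n * a' + m * b' = n * m"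
        using Gamma_gap nm by metis
      have iff': "v + c + (n * x + m * y) \<in> Gamma n m \<longleftrightarrow> a' \<le> x \<or> b' \<le> y" for x y
        by (rule Gamma_gap_add_iff[OF nm ab(3)])
      \<comment> \<open>g is n a or m b. Membership of v + c + g in \<open>Gamma\<close> bounds the
        coordinate of v + c that belongs to this generator, and v > l + g bounds the other
        one.\<close>
      have "a' \<le> a \<and> b' \<le> b"
      proof (cases "n * a \<le> m * b")
        case True
        then have ga: "g = n * a" using g by simp
        have "a' \<le> a" using iff'[of a 0] v(2) ga ab(2) by (simp add: ac_simps)
        moreover have "m * b' < m * b" using ab(3) gap(1) v(1) ga by linarith
        ultimately show ?thesis by simp
      next
        case False
        then have gb: "g = m * b" using g by simp
        have "b' \<le> b" using iff'[of 0 b] v(2) gb ab(1) by (simp add: ac_simps)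
        moreover have "n * a' < n * a" using ab(3) gap(1) v(1) gb by linarith
        ultimately show ?thesis by simp
      qed
      then obtain p q where "a = a' + p" "b = b' + q" using le_iff_add by metis
      then have "v = l + (n * p + m * q)" using ab(3) gap(1) by (simp add: algebra_simps)
      then show ?thesis using GammaI shifted_Gamma_iff by blast
    qed
  next
    fix e assume e: "e \<in> Gamma n m" "\<forall>v\<in>L \<union> shifted_Gamma n m l. v + e \<in> Gamma n m"
    have "(\<exists>h\<in>Gamma n m. e = c + h) \<or> n * m \<le> e + u" using K e by simp
    then show "(\<exists>h\<in>Gamma n m. e = c + g + h) \<or> n * m \<le> e + (l + g)"
    proof
      assume "\<exists>h\<in>Gamma n m. e = c + h"
      then obtain x y where xy: "e = c + (n * x + m * y)" unfolding Gamma_def by blast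
      have "l \<in> shifted_Gamma n m l" using Gamma_0 shifted_Gamma_iff by force
      then have "l + e \<in> Gamma n m" using e(2) by blast
      then have or: "a \<le> x \<or> b \<le> y" using iff[of x y] xy by (simp add: ac_simps)
      \<comment> \<open>When n a is the larger of the two, c + n a need not lie above c + g in the
        order of \<open>Gamma\<close>. Then g = m b, and the gap equation yields the second
        alternative n m <= e + (l + g).\<close>
      have 1: ?thesis if "e = c + n * a + h" "h \<in> Gamma n m" for h
      proof (cases "n * a \<le> m * b")
        case True then show ?thesis using that g by auto
      next
        case False
        then have "n * m \<le> e + (l + g)" using that gap(1) g by linarith
        then show ?thesis by simp
      qed
      have 2: ?thesis if "e = c + m * b + h" "h \<in> Gamma n m" for h
      proof (cases "m * b \<le> n * a")
        case True then show ?thesis using that g by auto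
      next
        case False
        then have "n * m \<le> e + (l + g)" using that gap(1) g by linarith
        then show ?thesis by simp
      qed
      from or show ?thesis
      proof
        assume "a \<le> x"
        then obtain p where "x = a + p" using le_iff_add by blast
        then show ?thesis using 1[of "n * p + m * y"] xy GammaI[of n p m y] by (simp add: algebra_simps)
      next
        assume "b \<le> y"
        then obtain p where "y = b + p" using le_iff_add by blast
        then show ?thesis using 2[of "n * x + m * p"] xy GammaI[of n x m p] by (simp add: algebra_simps)
      qed
    next
      assume "n * m \<le> e + u"
      then show ?thesis using lam by simp
    qed
  qed
qed

text \<open>The coordinates of the gap l + c identify u' as l + g: c moves L into
  \<open>Gamma\<close>, so by \<open>Gamma_gap_add_iff\<close> no element of L in l +
  \<open>Gamma\<close> lies below l + g, and l + g is in L because it is beyond u.\<close>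

lemma corner_of_step:
  assumes nm: "coprime n m" "0 < n" "0 < m"
    and cor: "corner_of n m L u c"
    and lam: "l \<notin> L" "u < l"
    and u': "u' = Inf (L \<inter> shifted_Gamma n m l)"
  shows "u' \<in> L" "u' \<in> shifted_Gamma n m l" "l \<le> u'"
    and "corner_of n m (L \<union> shifted_Gamma n m l) u' (c + (u' - l))"
proof -
  note J = cor[unfolded corner_of_def, THEN conjunct2, THEN conjunct1, rule_format]
    and I = cor[unfolded corner_of_def, THEN conjunct2, THEN conjunct2, THEN conjunct1, rule_format]
  have "l + c \<notin> Gamma n m" using I lam by blast
  then obtain a b where gap: "1 \<le> a" "1 \<le> b" "l + c + n * a + m * b = n * m"
    using Gamma_gap nm by metis
  define g where "g = min (n * a) (m * b)"
  have iff: "l + c + (n * a' + m * b') \<in> Gamma n m \<longleftrightarrow> a \<le> a' \<or> b \<le> b'" for a' b'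
    by (rule Gamma_gap_add_iff[OF nm gap(3)])
  have gG: "g \<in> Gamma n m" using g_def Gamma_left Gamma_right by (metis min_def)
  have lg: "l + g + c \<in> Gamma n m"
    using iff[of a 0] iff[of 0 b] by (auto simp: min_def g_def ac_simps)
  then have "l + g \<in> L" using I lam(2) by simp
  then have mem: "l + g \<in> L \<inter> shifted_Gamma n m l" using gG shifted_Gamma_iff by blast
  have "l + g \<le> v" if v: "v \<in> L \<inter> shifted_Gamma n m l" for v
  proof -
    obtain x y where xy: "v = l + (n * x + m * y)" using v by (auto simp: shifted_Gamma_iff Gamma_def)
    have "v + c \<in> Gamma n m" using v J by blast
    then have "a \<le> x \<or> b \<le> y" using iff[of x y] xy by (simp add: ac_simps)
    then have "n * a \<le> n * x \<or> m * b \<le> m * y" by auto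
    then show ?thesis using xy g_def by linarith
  qed
  then have u'g: "u' = l + g" unfolding u' using mem by (intro cInf_eq_minimum) auto
  show "u' \<in> L" "u' \<in> shifted_Gamma n m l" "l \<le> u'" using mem u'g by auto
  show "corner_of n m (L \<union> shifted_Gamma n m l) u' (c + (u' - l))"
    using corner_of_step_aux[OF nm cor lam gap(3,1,2) g_def] u'g by simp
qed

subsection \<open>Orders and weights\<close>

lemma fps_order_ge_iff: "enat k \<le> fps_order a \<longleftrightarrow> (\<forall>j<k. fps_nth a j = 0)"
proof (cases "a = 0")
  case False
  have "k \<le> subdegree a \<longleftrightarrow> (\<forall>j<k. fps_nth a j = 0)"
    using False subdegree_geI[of a k] by (auto intro: nth_less_subdegree_zero)
  then show ?thesis using False by (simp add: fps_order_def)
qed (simp add: fps_order_def)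

lemma fps_order_eq_iff: "fps_order a = enat k \<longleftrightarrow> fps_nth a k \<noteq> 0 \<and> (\<forall>j<k. fps_nth a j = 0)"
proof (cases "a = 0")
  case False
  then show ?thesis
    by (auto simp: fps_order_def intro: subdegreeI nth_less_subdegree_zero)
qed (simp add: fps_order_def)

lemma fps_order_mult: "fps_order (a * b) = fps_order a + fps_order b"
  by (auto simp: fps_order_def)

lemma fps_order_diff_eq:
  assumes "fps_order a < fps_order b"
  shows "fps_order (b - a) = fps_order a"
proof -
  obtain k where k: "fps_order a = enat k" using assms by (cases "fps_order a") auto
  then have "enat (Suc k) \<le> fps_order b" using assms by (metis Suc_ile_eq)
  then have "\<forall>j\<le>k. fps_nth b j = 0" using fps_order_ge_iff by auto
  moreover have "fps_nth a k \<noteq> 0" "\<forall>j<k. fps_nth a j = 0" using k fps_order_eq_iff by auto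
  ultimately have "fps_order (b - a) = enat k" unfolding fps_order_eq_iff by simp
  then show ?thesis using k by simp
qed

lemma nu_E_ge_iff: "enat k \<le> nu_E n m h \<longleftrightarrow> (\<forall>\<alpha> \<beta>. n * \<alpha> + m * \<beta> < k \<longrightarrow> coeff2 h \<alpha> \<beta> = 0)"
  unfolding nu_E_def le_Inf_iff Ball_def mem_Collect_eq
  by (metis enat_ord_simps(1) not_le)

lemma nu_E_eq_iff:
  "nu_E n m h = enat k \<longleftrightarrow> (\<forall>\<alpha> \<beta>. n * \<alpha> + m * \<beta> < k \<longrightarrow> coeff2 h \<alpha> \<beta> = 0) \<and>
     (\<exists>\<alpha> \<beta>. n * \<alpha> + m * \<beta> = k \<and> coeff2 h \<alpha> \<beta> \<noteq> 0)"
proof -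
  have "nu_E n m h = enat k \<longleftrightarrow> enat k \<le> nu_E n m h \<and> \<not> enat (Suc k) \<le> nu_E n m h"
    by (cases "nu_E n m h") auto
  also have "\<dots> \<longleftrightarrow> (\<forall>\<alpha> \<beta>. n * \<alpha> + m * \<beta> < k \<longrightarrow> coeff2 h \<alpha> \<beta> = 0) \<and>
     (\<exists>\<alpha> \<beta>. n * \<alpha> + m * \<beta> = k \<and> coeff2 h \<alpha> \<beta> \<noteq> 0)"
    unfolding nu_E_ge_iff by (metis less_Suc_eq)
  finally show ?thesis .
qed

lemma coeff2_diff: "coeff2 (g - h) \<alpha> \<beta> = coeff2 g \<alpha> \<beta> - coeff2 h \<alpha> \<beta>"
  by (simp add: coeff2_def)

lemma coeff2_mult:
  "coeff2 (g * h) \<alpha> \<beta> = (\<Sum>i\<le>\<alpha>. \<Sum>j\<le>\<beta>. coeff2 g i j * coeff2 h (\<alpha> - i) (\<beta> - j))"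
  by (simp add: coeff2_def fps_mult_nth fps_sum_nth atLeast0AtMost)

lemma coeff2_coord_x_mult:
  "coeff2 (coord_x * h) \<alpha> \<beta> = (if \<alpha> = 0 then 0 else coeff2 h (\<alpha> - 1) \<beta>)"
  by (simp add: coeff2_def coord_x_def)

lemma coeff2_coord_y_mult:
  "coeff2 (coord_y * h) \<alpha> \<beta> = (if \<beta> = 0 then 0 else coeff2 h \<alpha> (\<beta> - 1))"
  by (simp add: coeff2_def coord_y_def)

definition monomial2 :: "complex \<Rightarrow> nat \<Rightarrow> nat \<Rightarrow> series2" where
  "monomial2 c a b = Abs_fps (\<lambda>\<alpha>. if \<alpha> = a then Abs_fps (\<lambda>\<beta>. if \<beta> = b then c else 0) else 0)"

lemma coeff2_monomial2: "coeff2 (monomial2 c a b) \<alpha> \<beta> = (if \<alpha> = a \<and> \<beta> = b then c else 0)"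
  by (simp add: coeff2_def monomial2_def)

lemma coeff2_monomial2_mult:
  "coeff2 (monomial2 c a b * h) \<alpha> \<beta> = (if a \<le> \<alpha> \<and> b \<le> \<beta> then c * coeff2 h (\<alpha> - a) (\<beta> - b) else 0)"
proof -
  have "coeff2 (monomial2 c a b * h) \<alpha> \<beta> =
      (\<Sum>i\<le>\<alpha>. \<Sum>j\<le>\<beta>. if i = a then if j = b then c * coeff2 h (\<alpha> - i) (\<beta> - j) else 0 else 0)"
    unfolding coeff2_mult coeff2_monomial2 by (intro sum.cong refl) auto
  also have "\<dots> = (\<Sum>i\<le>\<alpha>. if i = a then (\<Sum>j\<le>\<beta>. if j = b then c * coeff2 h (\<alpha> - i) (\<beta> - j) else 0) else 0)"
    by (intro sum.cong refl) auto
  also have "\<dots> = (if a \<le> \<alpha> \<and> b \<le> \<beta> then c * coeff2 h (\<alpha> - a) (\<beta> - b) else 0)"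
    by simp
  finally show ?thesis .
qed

definition form_scale :: "series2 \<Rightarrow> form \<Rightarrow> form" where
  "form_scale h \<omega> = (h * fst \<omega>, h * snd \<omega>)"

definition form_diff :: "form \<Rightarrow> form \<Rightarrow> form" where
  "form_diff \<omega> \<eta> = (fst \<omega> - fst \<eta>, snd \<omega> - snd \<eta>)"

definition form_wedge :: "form \<Rightarrow> form \<Rightarrow> series2" where
  "form_wedge \<omega> \<eta> = fst \<omega> * snd \<eta> - fst \<eta> * snd \<omega>"

lemma nu_E_form_ge_iff:
  "enat k \<le> nu_E_form n m \<omega> \<longleftrightarrow>
     enat k \<le> nu_E n m (coord_x * fst \<omega>) \<and> enat k \<le> nu_E n m (coord_y * snd \<omega>)"
  by (simp add: nu_E_form_def)

lemma nu_E_monomial2_mult: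
  assumes "c \<noteq> 0"
  shows "nu_E n m (monomial2 c a b * h) = enat (n * a + m * b) + nu_E n m h"
proof (cases "nu_E n m h")
  case (enat k)
  then obtain \<alpha> \<beta> where ab: "n * \<alpha> + m * \<beta> = k" "coeff2 h \<alpha> \<beta> \<noteq> 0" and
    lt: "\<And>\<alpha> \<beta>. n * \<alpha> + m * \<beta> < k \<Longrightarrow> coeff2 h \<alpha> \<beta> = 0" unfolding nu_E_eq_iff by blast
  have "nu_E n m (monomial2 c a b * h) = enat (n * a + m * b + k)"
    unfolding nu_E_eq_iff
  proof (intro conjI allI impI exI)
    fix x y assume "n * x + m * y < n * a + m * b + k"
    moreover have "n * x = n * a + n * (x - a)" "m * y = m * b + m * (y - b)" if "a \<le> x" "b \<le> y"
      using that by (metis le_add_diff_inverse distrib_left)+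
    ultimately show "coeff2 (monomial2 c a b * h) x y = 0"
      using lt[of "x - a" "y - b"] by (auto simp: coeff2_monomial2_mult)
  next
    show "n * (a + \<alpha>) + m * (b + \<beta>) = n * a + m * b + k" using ab by (simp add: algebra_simps)
    show "coeff2 (monomial2 c a b * h) (a + \<alpha>) (b + \<beta>) \<noteq> 0"
      using ab assms by (simp add: coeff2_monomial2_mult)
  qed
  then show ?thesis using enat by simp
next
  case infinity
  then have "\<forall>\<alpha> \<beta>. coeff2 h \<alpha> \<beta> = 0"
    by (metis enat_ord_code(3) lessI nu_E_ge_iff)
  then have "\<forall>\<alpha> \<beta>. coeff2 (monomial2 c a b * h) \<alpha> \<beta> = 0" by (simp add: coeff2_monomial2_mult)
  then have "nu_E n m (monomial2 c a b * h) = \<infinity>"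
    by (metis (no_types, lifting) enat_ord_simps(5) nu_E_eq_iff not_enat_eq)
  then show ?thesis using infinity by simp
qed

lemma nu_E_form_scale:
  assumes "c \<noteq> 0"
  shows "nu_E_form n m (form_scale (monomial2 c a b) \<omega>) = enat (n * a + m * b) + nu_E_form n m \<omega>"
proof -
  have "coord_x * fst (form_scale (monomial2 c a b) \<omega>) = monomial2 c a b * (coord_x * fst \<omega>)"
    "coord_y * snd (form_scale (monomial2 c a b) \<omega>) = monomial2 c a b * (coord_y * snd \<omega>)"
    by (simp_all add: form_scale_def mult.left_commute)
  then show ?thesis
    by (simp only: nu_E_form_def nu_E_monomial2_mult[OF assms]) (simp add: min_def add_left_mono)
qed

lemma nu_E_diff_ge: "enat k \<le> nu_E n m g \<Longrightarrow> enat k \<le> nu_E n m h \<Longrightarrow> enat k \<le> nu_E n m (g - h)"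
  by (simp add: nu_E_ge_iff coeff2_diff)

lemma nu_E_form_diff_ge:
  "enat k \<le> nu_E_form n m \<omega> \<Longrightarrow> enat k \<le> nu_E_form n m \<eta> \<Longrightarrow> enat k \<le> nu_E_form n m (form_diff \<omega> \<eta>)"
  by (simp add: nu_E_form_ge_iff form_diff_def right_diff_distrib nu_E_diff_ge)

lemma nu_E_form_diff_eq:
  assumes "nu_E_form n m \<omega> = enat k" "enat k < nu_E_form n m \<eta>"
  shows "nu_E_form n m (form_diff \<omega> \<eta>) = enat k"
proof (rule antisym[OF _ nu_E_form_diff_ge])
  show "enat k \<le> nu_E_form n m \<omega>" "enat k \<le> nu_E_form n m \<eta>" using assms by simp_all
  show "nu_E_form n m (form_diff \<omega> \<eta>) \<le> enat k"
  proof (rule ccontr)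
    assume "\<not> nu_E_form n m (form_diff \<omega> \<eta>) \<le> enat k"
    then have 1: "enat (Suc k) \<le> nu_E_form n m (form_diff \<omega> \<eta>)"
      by (simp add: Suc_ile_eq not_le)
    have 2: "enat (Suc k) \<le> nu_E_form n m \<eta>" using assms(2) by (simp add: Suc_ile_eq)
    have "enat (Suc k) \<le> nu_E_form n m \<omega>"
      using 1 2 by (simp add: nu_E_form_ge_iff nu_E_ge_iff form_diff_def right_diff_distrib coeff2_diff)
    then show False using assms(1) by simp
  qed
qed

subsection \<open>Restriction to a curve\<close>

text \<open>This is the interface between geometry and values: an E-cusp enters the computations
  through the orders of x and y on it. The blowing-ups return in \<open>E_cusp_orders\<close>, which
  establishes the locale.\<close>

locale cusp_orders =
  fixes n m :: nat and \<phi> :: param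
  assumes coprime_nm: "coprime n m" and n_ge: "2 \<le> n" and n_less_m: "n < m"
    and order_x: "subdegree (fst \<phi>) = n" and order_y: "subdegree (snd \<phi>) = m"
begin

lemma n_pos: "0 < n" and m_pos: "0 < m"
  using n_ge n_less_m by simp_all

lemma x_neq_0: "fst \<phi> \<noteq> 0" and y_neq_0: "snd \<phi> \<noteq> 0"
  using order_x order_y n_pos m_pos by auto

lemma monomial_nth_below: "k < n * \<alpha> + m * \<beta> \<Longrightarrow> fps_nth (fst \<phi> ^ \<alpha> * snd \<phi> ^ \<beta>) k = 0"
  by (rule nth_less_subdegree_zero) (simp add: x_neq_0 y_neq_0 order_x order_y mult.commute)

lemma monomial_nth_leading: "fps_nth (fst \<phi> ^ \<alpha> * snd \<phi> ^ \<beta>) (n * \<alpha> + m * \<beta>) \<noteq> 0"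
proof -
  have "subdegree (fst \<phi> ^ \<alpha> * snd \<phi> ^ \<beta>) = n * \<alpha> + m * \<beta>"
    by (simp add: x_neq_0 y_neq_0 order_x order_y mult.commute)
  then show ?thesis using nth_subdegree_nonzero[of "fst \<phi> ^ \<alpha> * snd \<phi> ^ \<beta>"] x_neq_0 y_neq_0 by simp
qed

lemma monomial_nth_zero: "k < \<alpha> \<or> k < \<beta> \<Longrightarrow> fps_nth (fst \<phi> ^ \<alpha> * snd \<phi> ^ \<beta>) k = 0"
proof (rule monomial_nth_below)
  assume "k < \<alpha> \<or> k < \<beta>"
  moreover have "\<alpha> \<le> n * \<alpha>" "\<beta> \<le> m * \<beta>" using n_pos m_pos by simp_all
  ultimately show "k < n * \<alpha> + m * \<beta>" by linarith
qed

lemma monomial_nth_nonzeroD: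
  "fps_nth (fst \<phi> ^ \<alpha> * snd \<phi> ^ \<beta>) k \<noteq> 0 \<Longrightarrow> \<alpha> \<le> k \<and> \<beta> \<le> k"
  using monomial_nth_zero by (meson not_le)

lemma restrict_nth:
  assumes "k \<le> K"
  shows "fps_nth (restrict_to \<phi> h) k =
    (\<Sum>(\<alpha>, \<beta>)\<in>{..K} \<times> {..K}. coeff2 h \<alpha> \<beta> * fps_nth (fst \<phi> ^ \<alpha> * snd \<phi> ^ \<beta>) k)"
  unfolding restrict_to_def fps_nth_Abs_fps sum.cartesian_product
proof (rule sum.mono_neutral_left)
  show "{..k} \<times> {..k} \<subseteq> {..K} \<times> {..K}" using assms by auto
  show "\<forall>i\<in>{..K} \<times> {..K} - {..k} \<times> {..k}. (case i of (\<alpha>, \<beta>) \<Rightarrow>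
      coeff2 h \<alpha> \<beta> * fps_nth (fst \<phi> ^ \<alpha> * snd \<phi> ^ \<beta>) k) = 0"
    by (auto dest: monomial_nth_nonzeroD)
qed simp

lemma restrict_diff: "restrict_to \<phi> (g - h) = restrict_to \<phi> g - restrict_to \<phi> h"
  by (rule fps_ext) (simp add: restrict_nth[OF order_refl] coeff2_diff left_diff_distrib
      sum_subtractf case_prod_unfold)

text \<open>Only monomials with exponents at most k reach the coefficient of t^k, so the
  substitution is a finite sum, and products of monomials are regrouped by total exponent. The
  uniform cut-off in \<open>restrict_nth\<close> lets all coefficients up to k share one index
  set.\<close>

lemma restrict_mult: "restrict_to \<phi> (g * h) = restrict_to \<phi> g * restrict_to \<phi> h"
proof (rule fps_ext)
  fix k :: nat
  let ?M = "\<lambda>(\<alpha> :: nat) (\<beta> :: nat). fst \<phi> ^ \<alpha> * snd \<phi> ^ \<beta>"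
  let ?c = "\<lambda>i j i' j'. coeff2 g i j * coeff2 h i' j'"
  let ?Q = "{..k} \<times> {..k}"
  have "fps_nth (restrict_to \<phi> g * restrict_to \<phi> h) k =
      (\<Sum>p\<le>k. (\<Sum>(i, j)\<in>?Q. coeff2 g i j * fps_nth (?M i j) p) *
        (\<Sum>(i', j')\<in>?Q. coeff2 h i' j' * fps_nth (?M i' j') (k - p)))"
    unfolding fps_mult_nth[of "restrict_to \<phi> g"] atLeast0AtMost
    by (intro sum.cong refl) (simp add: restrict_nth[of _ k])
  also have "\<dots> = (\<Sum>p\<le>k. \<Sum>(i, j)\<in>?Q. \<Sum>(i', j')\<in>?Q.
      ?c i j i' j' * (fps_nth (?M i j) p * fps_nth (?M i' j') (k - p)))"
    by (simp add: sum_product case_prod_unfold ac_simps)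
  also have "\<dots> = (\<Sum>(i, j)\<in>?Q. \<Sum>(i', j')\<in>?Q. \<Sum>p\<le>k.
      ?c i j i' j' * (fps_nth (?M i j) p * fps_nth (?M i' j') (k - p)))"
    unfolding case_prod_unfold by (subst sum.swap, rule sum.cong[OF refl], subst sum.swap, rule refl)
  also have "\<dots> = (\<Sum>(i, j)\<in>?Q. \<Sum>(i', j')\<in>?Q. ?c i j i' j' * fps_nth (?M (i + i') (j + j')) k)"
  proof -
    have "(\<Sum>p\<le>k. ?c i j i' j' * (fps_nth (?M i j) p * fps_nth (?M i' j') (k - p))) =
        ?c i j i' j' * fps_nth (?M (i + i') (j + j')) k" for i j i' j'
    proof -
      have "?M (i + i') (j + j') = ?M i j * ?M i' j'" by (simp add: power_add ac_simps)
      then show ?thesis by (simp add: fps_mult_nth[of "?M i j"] atLeast0AtMost sum_distrib_left)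
    qed
    then show ?thesis by simp
  qed
  also have "\<dots> = (\<Sum>((i, j), (i', j'))\<in>?Q \<times> ?Q. ?c i j i' j' * fps_nth (?M (i + i') (j + j')) k)"
    by (simp add: sum.cartesian_product case_prod_unfold)
  also have "\<dots> = (\<Sum>((i, j), (i', j'))\<in>{((i, j), (i', j')). i + i' \<le> k \<and> j + j' \<le> k}.
      ?c i j i' j' * fps_nth (?M (i + i') (j + j')) k)"
    by (rule sum.mono_neutral_right) (auto dest: monomial_nth_nonzeroD)
  also have "\<dots> = (\<Sum>((\<alpha>, \<beta>), (i, j))\<in>Sigma ?Q (\<lambda>(\<alpha>, \<beta>). {..\<alpha>} \<times> {..\<beta>}).
      ?c i j (\<alpha> - i) (\<beta> - j) * fps_nth (?M \<alpha> \<beta>) k)"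
    by (rule sum.reindex_bij_witness[where
          i = "\<lambda>((\<alpha>, \<beta>), (i, j)). ((i, j), (\<alpha> - i, \<beta> - j))" and
          j = "\<lambda>((i, j), (i', j')). ((i + i', j + j'), (i, j))"]) auto
  also have "\<dots> = (\<Sum>(\<alpha>, \<beta>)\<in>?Q. \<Sum>(i, j)\<in>{..\<alpha>} \<times> {..\<beta>}.
      ?c i j (\<alpha> - i) (\<beta> - j) * fps_nth (?M \<alpha> \<beta>) k)"
    by (subst sum.Sigma[symmetric]) (auto simp: case_prod_unfold)
  also have "\<dots> = (\<Sum>(\<alpha>, \<beta>)\<in>?Q. coeff2 (g * h) \<alpha> \<beta> * fps_nth (?M \<alpha> \<beta>) k)"
    by (simp add: coeff2_mult sum_distrib_right sum.cartesian_product case_prod_unfold)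
  finally show "fps_nth (restrict_to \<phi> (g * h)) k = fps_nth (restrict_to \<phi> g * restrict_to \<phi> h) k"
    by (simp add: restrict_nth[of k k])
qed

lemma restrict_monomial2: "restrict_to \<phi> (monomial2 c a b) = fps_const c * (fst \<phi> ^ a * snd \<phi> ^ b)"
proof (rule fps_ext)
  fix k :: nat
  have "fps_nth (restrict_to \<phi> (monomial2 c a b)) k =
      (\<Sum>p\<in>{..k} \<times> {..k}. if p = (a, b) then c * fps_nth (fst \<phi> ^ a * snd \<phi> ^ b) k else 0)"
    unfolding restrict_nth[OF order_refl] coeff2_monomial2 case_prod_unfold
    by (intro sum.cong refl) auto
  also have "\<dots> = c * fps_nth (fst \<phi> ^ a * snd \<phi> ^ b) k"
    using monomial_nth_zero[of k a b] by (auto simp: not_le)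
  finally show "fps_nth (restrict_to \<phi> (monomial2 c a b)) k = fps_nth (fps_const c * (fst \<phi> ^ a * snd \<phi> ^ b)) k"
    by simp
qed

lemma coord_x_eq: "coord_x = monomial2 1 1 0" and coord_y_eq: "coord_y = monomial2 1 0 1"
  by (auto simp: coord_x_def coord_y_def monomial2_def fps_eq_iff)

lemma restrict_coord_x: "restrict_to \<phi> coord_x = fst \<phi>"
  and restrict_coord_y: "restrict_to \<phi> coord_y = snd \<phi>"
  by (simp_all add: coord_x_eq coord_y_eq restrict_monomial2)

lemma restrict_nth_below:
  assumes "enat k \<le> nu_E n m h" "j < k"
  shows "fps_nth (restrict_to \<phi> h) j = 0"
  unfolding restrict_nth[OF order_refl]
proof (rule sum.neutral, clarify)
  fix \<alpha> \<beta>
  show "coeff2 h \<alpha> \<beta> * fps_nth (fst \<phi> ^ \<alpha> * snd \<phi> ^ \<beta>) j = 0"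
  proof (cases "n * \<alpha> + m * \<beta> < k")
    case True
    then show ?thesis using assms(1) nu_E_ge_iff by simp
  next
    case False
    then show ?thesis using monomial_nth_below[of j \<alpha> \<beta>] assms(2) by simp
  qed
qed

lemma restrict_order_ge: "nu_E n m h \<le> fps_order (restrict_to \<phi> h)"
proof (rule ccontr)
  assume "\<not> ?thesis"
  then obtain k where k: "fps_order (restrict_to \<phi> h) = enat k" "enat (Suc k) \<le> nu_E n m h"
    by (cases "fps_order (restrict_to \<phi> h)") (auto simp: not_le Suc_ile_eq)
  then show False using restrict_nth_below[OF k(2), of k] by (simp add: fps_order_eq_iff)
qed

text \<open>Below weight \<open>n * m\<close> a weight determines its monomial, so leading terms cannot cancel.\<close>

lemma restrict_nth_leading:
  assumes "n * a + m * b < n * m" "enat (n * a + m * b) \<le> nu_E n m h"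
  shows "fps_nth (restrict_to \<phi> h) (n * a + m * b) =
    coeff2 h a b * fps_nth (fst \<phi> ^ a * snd \<phi> ^ b) (n * a + m * b)"
proof -
  let ?k = "n * a + m * b"
  have "a \<le> ?k" "b \<le> ?k" using n_pos m_pos by (simp_all add: trans_le_add1 trans_le_add2)
  have "fps_nth (restrict_to \<phi> h) ?k =
      (\<Sum>p\<in>{..?k} \<times> {..?k}. if p = (a, b) then coeff2 h a b * fps_nth (fst \<phi> ^ a * snd \<phi> ^ b) ?k else 0)"
    unfolding restrict_nth[OF order_refl]
  proof (rule sum.cong[OF refl], clarify)
    fix \<alpha> \<beta>
    consider "n * \<alpha> + m * \<beta> < ?k" | "n * \<alpha> + m * \<beta> = ?k" | "?k < n * \<alpha> + m * \<beta>" by linarith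
    then show "coeff2 h \<alpha> \<beta> * fps_nth (fst \<phi> ^ \<alpha> * snd \<phi> ^ \<beta>) ?k =
        (if (\<alpha>, \<beta>) = (a, b) then coeff2 h a b * fps_nth (fst \<phi> ^ a * snd \<phi> ^ b) ?k else 0)"
    proof cases
      case 1
      then show ?thesis using assms(2) by (auto simp: nu_E_ge_iff)
    next
      case 2
      then have "\<alpha> = a \<and> \<beta> = b" using weight_unique[OF coprime_nm n_pos m_pos, of \<alpha> \<beta> a b] assms(1) by simp
      then show ?thesis by simp
    next
      case 3
      then show ?thesis using monomial_nth_below[OF 3] by auto
    qed
  qed
  also have "\<dots> = coeff2 h a b * fps_nth (fst \<phi> ^ a * snd \<phi> ^ b) ?k"
    using \<open>a \<le> ?k\<close> \<open>b \<le> ?k\<close> by (simp only: sum.delta finite_cartesian_product finite_atMost) simp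
  finally show ?thesis .
qed

lemma restrict_order_eq:
  assumes "nu_E n m h = enat k" "k < n * m"
  shows "fps_order (restrict_to \<phi> h) = enat k"
proof -
  obtain a b where ab: "n * a + m * b = k" "coeff2 h a b \<noteq> 0" using assms(1) nu_E_eq_iff by blast
  have "fps_nth (restrict_to \<phi> h) k \<noteq> 0"
    using restrict_nth_leading[of a b h] assms ab monomial_nth_leading[of a b] by simp
  then show ?thesis using restrict_nth_below[of k h] assms(1) by (simp add: fps_order_eq_iff)
qed

text \<open>The weight is at most the order, hence below n m, and then
  \<open>restrict_order_eq\<close> makes it the order. This turns an order observed on one cusp into
  a weight, which every other cusp sees too.\<close>

lemma nu_E_eq_restrict_order:
  assumes "fps_order (restrict_to \<phi> h) = enat k" "k < n * m"
  shows "nu_E n m h = enat k"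
proof -
  obtain j where "nu_E n m h = enat j" "j \<le> k"
    using restrict_order_ge[of h] assms(1) by (cases "nu_E n m h") auto
  then show ?thesis using restrict_order_eq[of h j] assms by simp
qed

lemma restrict_order_Gamma:
  assumes "fps_order (restrict_to \<phi> h) = enat k"
  shows "k \<in> Gamma n m"
proof (cases "k < n * m")
  case True
  then have "nu_E n m h = enat k" using assms nu_E_eq_restrict_order by blast
  then show ?thesis unfolding nu_E_eq_iff using GammaI by blast
next
  case False
  then show ?thesis using Gamma_ge[OF coprime_nm n_pos] by simp
qed

end

subsection \<open>Axes and critical orders\<close>

lemma Lambda_upto_insert:
  "-1 \<le> l \<Longrightarrow> Lambda_upto n m lam l = Lambda_upto n m lam (l - 1) \<union> shifted_Gamma n m (lam l)"
proof -
  assume "-1 \<le> l"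
  then have "{-1..l} = insert l {-1..l - 1}" by auto
  then show ?thesis by (auto simp: Lambda_upto_def)
qed

lemma Lambda_upto_mono: "k \<le> l \<Longrightarrow> Lambda_upto n m lam k \<subseteq> Lambda_upto n m lam l"
  unfolding Lambda_upto_def by (intro UN_mono) auto

lemma Lambda_upto_iff:
  "v \<in> Lambda_upto n m lam l \<longleftrightarrow> (\<exists>j a b. -1 \<le> j \<and> j \<le> l \<and> v = lam j + (n * a + m * b))"
  unfolding Lambda_upto_def shifted_Gamma_iff Gamma_def UN_iff Bex_def mem_Collect_eq atLeastAtMost_iff
  by blast

text \<open>The bound l is excluded: u_l and t_l depend only on entries up to l - 1, so they are
  under control while lam l is still being placed.\<close>

definition increasing_upto :: "nat \<Rightarrow> nat \<Rightarrow> (int \<Rightarrow> nat) \<Rightarrow> int \<Rightarrow> bool" where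
  "increasing_upto n m lam l \<longleftrightarrow> lam (-1) = n \<and> lam 0 = m \<and>
     (\<forall>j\<in>{1..<l}. lam j \<notin> Lambda_upto n m lam (j - 1) \<and> axis n m lam j < lam j)"

text \<open>The relation between consecutive critical orders is kept in additive form to avoid
  truncating subtraction. The shift by n + m is the order of the factor in
  \<open>wedge_identity\<close>.\<close>

definition regular_at :: "nat \<Rightarrow> nat \<Rightarrow> (int \<Rightarrow> nat) \<Rightarrow> int \<Rightarrow> bool" where
  "regular_at n m lam l \<longleftrightarrow>
     corner_of n m (Lambda_upto n m lam (l - 1)) (axis n m lam l) (critical_order n m lam l - (n + m)) \<and>
     n + m \<le> critical_order n m lam l \<and> critical_order n m lam l \<le> axis n m lam l \<and>
     critical_order n m lam l < n * m \<and>
     critical_order n m lam l + lam (l - 1) = critical_order n m lam (l - 1) + axis n m lam l \<and>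
     axis n m lam l \<in> Lambda_upto n m lam (l - 2) \<and>
     axis n m lam l \<in> shifted_Gamma n m (lam (l - 1))"

lemma sum_less_prod:
  assumes "2 \<le> n" "n < (m :: nat)"
  shows "n + m < n * m"
proof -
  have "2 * m \<le> n * m" using assms by simp
  then show ?thesis using assms by linarith
qed

lemma critical_order_0: "critical_order n m lam 0 = m"
  and critical_order_m1: "critical_order n m lam (-1) = n"
  by (subst critical_order.simps, simp)+

lemma critical_order_pos:
  "1 \<le> l \<Longrightarrow> critical_order n m lam l = critical_order n m lam (l - 1) + axis n m lam l - lam (l - 1)"
  by (subst critical_order.simps) simp

text \<open>Here the semimodule is \<open>Gamma\<close> without 0, u_1 = t_1 = n + m and the corner
  constant is 0, so the dual condition is trivial.\<close>

lemma regular_at_1: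
  assumes nm: "coprime n m" "2 \<le> n" "n < m" and lam: "lam (-1) = n" "lam 0 = m"
  shows "regular_at n m lam 1"
proof -
  note sp = sum_less_prod[OF nm(2,3)]
  have pos: "0 < n" "0 < m" using nm by simp_all
  have L0: "Lambda_upto n m lam (-1) = shifted_Gamma n m n"
    using lam by (simp add: Lambda_upto_def)
  have L1: "Lambda_upto n m lam 0 = shifted_Gamma n m n \<union> shifted_Gamma n m m"
    using Lambda_upto_insert[of 0 n m lam] L0 lam by simp
  have ax: "axis n m lam 1 = Inf (shifted_Gamma n m n \<inter> shifted_Gamma n m m)"
    using L0 lam by (simp add: axis_def)
  have mem: "n + m \<in> shifted_Gamma n m n \<inter> shifted_Gamma n m m"
    using Gamma_left[of n 1 m] Gamma_right[of m 1 n] by (auto simp: shifted_Gamma_iff)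
  have "n + m \<le> v" if v: "v \<in> shifted_Gamma n m n \<inter> shifted_Gamma n m m" for v
  proof (rule ccontr)
    assume "\<not> n + m \<le> v"
    obtain a b where "v = n + (n * a + m * b)" using v by (auto simp: shifted_Gamma_iff Gamma_def)
    then have ab: "v = n * (a + 1) + m * b" by simp
    obtain a' b' where "v = m + (n * a' + m * b')" using v by (auto simp: shifted_Gamma_iff Gamma_def)
    then have ab': "v = n * a' + m * (b' + 1)" by simp
    \<comment> \<open>Since v < n + m < n m, v is the weight of a single monomial, which is
      divisible by both x and y.\<close>
    have "a + 1 = a' \<and> b = b' + 1"
      using weight_unique[OF nm(1) pos, of "a + 1" b a' "b' + 1"] ab ab' \<open>\<not> n + m \<le> v\<close> sp by simp
    then have "v = n * (a + 1) + m * (b' + 1)" using ab by simp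
    then have "v = n + m + (n * a + m * b')" by simp
    then show False using \<open>\<not> n + m \<le> v\<close> by simp
  qed
  then have u: "axis n m lam 1 = n + m" unfolding ax using mem by (intro cInf_eq_minimum) auto
  have t: "critical_order n m lam 1 = n + m"
    using u lam by (simp add: critical_order_pos critical_order_0)
  have "corner_of n m (Lambda_upto n m lam 0) (n + m) 0"
    unfolding corner_of_def
  proof (intro conjI ballI allI impI)
    show "0 + (n + m) \<le> n * m" using sp by simp
    have nG: "n \<in> Gamma n m" "m \<in> Gamma n m" using Gamma_left[of n 1 m] Gamma_right[of m 1 n] by simp_all
    show "v + 0 \<in> Gamma n m" if "v \<in> Lambda_upto n m lam 0" for v
      using that nG Gamma_add unfolding L1 by (auto simp: shifted_Gamma_iff)
    show "v \<in> Lambda_upto n m lam 0" if v: "n + m < v" "v + 0 \<in> Gamma n m" for v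
    proof -
      obtain a b where ab: "v = n * a + m * b" using v unfolding Gamma_def by auto
      have "v = n + (n * a' + m * b)" if "a = Suc a'" for a' using ab that by simp
      moreover have "v = m + (n * a + m * b')" if "b = Suc b'" for b' using ab that by simp
      moreover have "(\<exists>a'. a = Suc a') \<or> (\<exists>b'. b = Suc b')" using ab v(1) by (cases a; cases b) auto
      ultimately have "(\<exists>g\<in>Gamma n m. v = n + g) \<or> (\<exists>g\<in>Gamma n m. v = m + g)" using GammaI by blast
      then show ?thesis unfolding L1 shifted_Gamma_iff Un_iff .
    qed
    show "(\<exists>g\<in>Gamma n m. e = 0 + g) \<or> n * m \<le> e + (n + m)" if "e \<in> Gamma n m" for e
      using that by simp
  qed
  then show ?thesis
    using mem u t sp lam by (simp add: regular_at_def L0 critical_order_0)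
qed

lemma regular_at_step:
  assumes nm: "coprime n m" "2 \<le> n" "n < m" and l: "1 \<le> l"
    and reg: "regular_at n m lam l"
    and new: "lam l \<notin> Lambda_upto n m lam (l - 1)" "axis n m lam l < lam l"
  shows "regular_at n m lam (l + 1)"
proof -
  have pos: "0 < n" "0 < m" using nm by simp_all
  let ?t = "critical_order n m lam" and ?u = "axis n m lam" and ?L = "Lambda_upto n m lam"
  have ax: "?u (l + 1) = Inf (?L (l - 1) \<inter> shifted_Gamma n m (lam l))"
    using l by (simp add: axis_def)
  have cor: "corner_of n m (?L (l - 1)) (?u l) (?t l - (n + m))" using reg by (simp add: regular_at_def)
  note step = corner_of_step[OF nm(1) pos cor new ax]
  have L: "?L l = ?L (l - 1) \<union> shifted_Gamma n m (lam l)" using Lambda_upto_insert l by simp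
  have t: "?t (l + 1) = ?t l + ?u (l + 1) - lam l" using critical_order_pos[of "l + 1"] l by simp
  then have tu: "?t (l + 1) + lam l = ?t l + ?u (l + 1)" using step(3) by simp
  have nmt: "n + m \<le> ?t l" "?t l \<le> ?u l" using reg by (simp_all add: regular_at_def)
  then have le: "n + m \<le> ?t (l + 1)" "?t (l + 1) \<le> ?u (l + 1)" using tu step(3) new(2) by linarith+
  have "?t l - (n + m) + (?u (l + 1) - lam l) = ?t (l + 1) - (n + m)"
    using tu step(3) nmt by linarith
  then have cor': "corner_of n m (?L l) (?u (l + 1)) (?t (l + 1) - (n + m))"
    using step(4) L by simp
  then have "?t (l + 1) - (n + m) + ?u (l + 1) \<le> n * m" by (simp add: corner_of_def)
  \<comment> \<open>As t <= u, the bound gives 2 t <= n m + n + m, which is less than 2 n m.\<close>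
  then have "?t (l + 1) < n * m" using le sum_less_prod[OF nm(2,3)] by linarith
  then show ?thesis using cor' le tu step(1,2) by (simp add: regular_at_def)
qed

lemma regular_at:
  assumes nm: "coprime n m" "2 \<le> n" "n < m" and l: "1 \<le> l"
    and inc: "increasing_upto n m lam l"
  shows "regular_at n m lam l"
  using l inc
proof (induction l rule: int_ge_induct)
  case base
  then show ?case using regular_at_1[OF nm] by (simp add: increasing_upto_def)
next
  case (step l)
  then have "increasing_upto n m lam l" by (simp add: increasing_upto_def)
  then show ?case using step regular_at_step[OF nm step(1)] by (simp add: increasing_upto_def)
qed

text \<open>Call lam j - t_j the defect of j. By t_(j+1) + lam j = t_j + u_(j+1), it would stay
  constant if lam (j+1) were u_(j+1), and lam (j+1) is larger. The defects at -1 and 0 are both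
  zero, hence the restriction j >= 1.\<close>

lemma defect_less:
  assumes nm: "coprime n m" "2 \<le> n" "n < m" and inc: "increasing_upto n m lam l"
    and j: "1 \<le> j" "j < l" and k: "-1 \<le> k" "k < j"
  shows "lam k + critical_order n m lam j < lam j + critical_order n m lam k"
  using j k
proof (induction j rule: int_ge_induct)
  case base
  have reg: "regular_at n m lam 1" using regular_at[OF nm, of 1] inc by (simp add: increasing_upto_def)
  have "axis n m lam 1 < lam 1" using inc base by (simp add: increasing_upto_def)
  then have "lam 0 + critical_order n m lam 1 < lam 1 + critical_order n m lam 0"
    using reg by (simp add: regular_at_def)
  moreover have "k = 0 \<or> k = -1" using base by linarith
  moreover have "lam 0 = m" "lam (-1) = n" using inc by (simp_all add: increasing_upto_def)
  ultimately show ?case by (auto simp: critical_order_0 critical_order_m1)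
next
  case (step j)
  have "increasing_upto n m lam (j + 1)" using inc step by (simp add: increasing_upto_def)
  then have "regular_at n m lam (j + 1)" using regular_at[OF nm] step by simp
  moreover have "axis n m lam (j + 1) < lam (j + 1)" using inc step by (simp add: increasing_upto_def)
  ultimately have "lam j + critical_order n m lam (j + 1) < lam (j + 1) + critical_order n m lam j"
    by (simp add: regular_at_def)
  moreover have "k = j \<or> lam k + critical_order n m lam j < lam j + critical_order n m lam k"
    using step by (cases "k = j") auto
  ultimately show ?case by auto
qed

subsection \<open>Differential values and weights\<close>

lemma fps_mult_nth_lowest:
  fixes a b :: "'a :: comm_ring_1 fps"
  assumes "\<forall>j<k. fps_nth b j = 0"
  shows "fps_nth (a * b) k = fps_nth a 0 * fps_nth b k"
proof -
  have "fps_nth (a * b) k = (\<Sum>i=0..k. if i = 0 then fps_nth a 0 * fps_nth b k else 0)"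
    unfolding fps_mult_nth using assms by (intro sum.cong refl) auto
  then show ?thesis by simp
qed

lemma fps_X_mult_deriv_factor:
  assumes "subdegree f = k" "0 < k" "f \<noteq> (0 :: complex fps)"
  obtains g where "fps_X * fps_deriv f = f * g" "fps_nth g 0 = of_nat k"
proof -
  have nth: "fps_nth (fps_X * fps_deriv f) j = of_nat j * fps_nth f j" for j
    by (cases j) auto
  have "subdegree f \<le> subdegree (fps_X * fps_deriv f)" if "fps_X * fps_deriv f \<noteq> 0"
    by (rule subdegree_geI[OF that]) (simp only: nth nth_less_subdegree_zero mult_zero_right)
  then have "f dvd fps_X * fps_deriv f" 
    using fps_dvd_iff[OF assms(3), of "fps_X * fps_deriv f"] by (metis dvd_0_right)
  then obtain g where g: "fps_X * fps_deriv f = f * g" by blast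
  have low: "\<forall>j<k. fps_nth f j = 0" using assms(1) nth_less_subdegree_zero by blast
  have "fps_nth (f * g) k = fps_nth f k * fps_nth g 0"
    using fps_mult_nth_lowest[OF low, of g] by (simp only: mult.commute)
  then have "fps_nth f k * of_nat k = fps_nth f k * fps_nth g 0" using nth[of k] g by (simp only: mult.commute)
  moreover have "fps_nth f k \<noteq> 0" using assms nth_subdegree_nonzero by blast
  ultimately have "fps_nth g 0 = of_nat k" by (simp only: mult_cancel_left) simp
  then show ?thesis using that g by blast
qed

context cusp_orders
begin

text \<open>In a dx + b dy = (x a) dx/x + (y b) dy/y, the logarithmic forms dx/x and dy/y pull back
  to units times dt/t, whose constant terms are the orders of x and y.\<close>

lemma log_pullback_factor:
  obtains g h where "fps_nth g 0 = of_nat n" "fps_nth h 0 = of_nat m"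
    "\<And>\<omega>. log_pullback \<phi> \<omega> =
      g * restrict_to \<phi> (coord_x * fst \<omega>) + h * restrict_to \<phi> (coord_y * snd \<omega>)"
proof -
  obtain g where g: "fps_X * fps_deriv (fst \<phi>) = fst \<phi> * g" "fps_nth g 0 = of_nat n"
    using fps_X_mult_deriv_factor[OF order_x n_pos x_neq_0] .
  obtain h where h: "fps_X * fps_deriv (snd \<phi>) = snd \<phi> * h" "fps_nth h 0 = of_nat m"
    using fps_X_mult_deriv_factor[OF order_y m_pos y_neq_0] .
  have "log_pullback \<phi> \<omega> =
      g * restrict_to \<phi> (coord_x * fst \<omega>) + h * restrict_to \<phi> (coord_y * snd \<omega>)" for \<omega>
  proof -
    have "log_pullback \<phi> \<omega> = restrict_to \<phi> (fst \<omega>) * (fps_X * fps_deriv (fst \<phi>)) +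
        restrict_to \<phi> (snd \<omega>) * (fps_X * fps_deriv (snd \<phi>))"
      by (simp add: log_pullback_def algebra_simps)
    then show ?thesis unfolding g h
      by (simp add: restrict_mult restrict_coord_x restrict_coord_y algebra_simps)
  qed
  then show ?thesis using that g h by blast
qed

lemma log_pullback_scale: "log_pullback \<phi> (form_scale h \<omega>) = restrict_to \<phi> h * log_pullback \<phi> \<omega>"
  by (simp add: log_pullback_def form_scale_def restrict_mult algebra_simps)

lemma log_pullback_diff:
  "log_pullback \<phi> (form_diff \<omega> \<eta>) = log_pullback \<phi> \<omega> - log_pullback \<phi> \<eta>"
  by (simp add: log_pullback_def form_diff_def restrict_diff algebra_simps)

lemma diff_value_scale:
  assumes "c \<noteq> 0"
  shows "diff_value \<phi> (form_scale (monomial2 c a b) \<omega>) = enat (n * a + m * b) + diff_value \<phi> \<omega>"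
proof -
  have "fps_order (restrict_to \<phi> (monomial2 c a b)) = enat (n * a + m * b)"
    unfolding restrict_monomial2 fps_order_eq_iff
    using assms monomial_nth_leading[of a b] monomial_nth_below[of _ a b] by simp
  then show ?thesis by (simp add: diff_value_def log_pullback_scale fps_order_mult)
qed

lemma nu_E_form_le_diff_value: "nu_E_form n m \<omega> \<le> diff_value \<phi> \<omega>"
proof (rule ccontr)
  assume "\<not> ?thesis"
  then obtain k where k: "fps_order (log_pullback \<phi> \<omega>) = enat k" "enat (Suc k) \<le> nu_E_form n m \<omega>"
    by (cases "diff_value \<phi> \<omega>") (auto simp: not_le Suc_ile_eq diff_value_def)
  obtain g h where gh: "\<And>\<omega>. log_pullback \<phi> \<omega> =
      g * restrict_to \<phi> (coord_x * fst \<omega>) + h * restrict_to \<phi> (coord_y * snd \<omega>)"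
    using log_pullback_factor by metis
  have "\<forall>j\<le>k. fps_nth (restrict_to \<phi> (coord_x * fst \<omega>)) j = 0"
    "\<forall>j\<le>k. fps_nth (restrict_to \<phi> (coord_y * snd \<omega>)) j = 0"
    using k(2) restrict_nth_below nu_E_form_ge_iff by (auto simp: less_Suc_eq_le)
  then have "fps_nth (log_pullback \<phi> \<omega>) k = 0" unfolding gh by (simp add: fps_mult_nth)
  then show False using k(1) by (simp add: fps_order_eq_iff)
qed

text \<open>Below n m a single monomial has weight k. With p, q its coefficients in x a and y b, the
  coefficient of t^k is a nonzero multiple of n p + m q. It vanishes while p, q are not both zero,
  so neither is zero, and the monomial is divisible by x y.\<close>

lemma resonant:
  assumes "nu_E_form n m \<omega> = enat k" "k < n * m" "diff_value \<phi> \<omega> \<noteq> enat k"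
  shows "fps_order (restrict_to \<phi> (coord_y * snd \<omega>)) = enat k" "\<exists>e\<in>Gamma n m. k = n + m + e"
proof -
  let ?P = "coord_x * fst \<omega>" and ?Q = "coord_y * snd \<omega>"
  have ge: "enat k \<le> nu_E n m ?P" "enat k \<le> nu_E n m ?Q"
    using assms(1) nu_E_form_ge_iff by (metis order_refl)+
  have "nu_E n m ?P = enat k \<or> nu_E n m ?Q = enat k"
    using assms(1) by (auto simp: nu_E_form_def min_def split: if_splits)
  then obtain a b where ab: "n * a + m * b = k" "coeff2 ?P a b \<noteq> 0 \<or> coeff2 ?Q a b \<noteq> 0"
    unfolding nu_E_eq_iff by blast
  obtain g h where gh: "fps_nth g 0 = of_nat n" "fps_nth h 0 = of_nat m"
    "\<And>\<omega>. log_pullback \<phi> \<omega> = g * restrict_to \<phi> (coord_x * fst \<omega>) + h * restrict_to \<phi> (coord_y * snd \<omega>)"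
    using log_pullback_factor by metis
  define c where "c = fps_nth (fst \<phi> ^ a * snd \<phi> ^ b) k"
  have c: "c \<noteq> 0" unfolding c_def using monomial_nth_leading[of a b] ab by simp
  have P: "fps_nth (restrict_to \<phi> ?P) k = coeff2 ?P a b * c"
    using restrict_nth_leading[of a b ?P] ab(1) assms(2) ge(1) c_def by simp
  have Q: "fps_nth (restrict_to \<phi> ?Q) k = coeff2 ?Q a b * c"
    using restrict_nth_leading[of a b ?Q] ab(1) assms(2) ge(2) c_def by simp
  have below: "\<forall>j<k. fps_nth (restrict_to \<phi> ?P) j = 0" "\<forall>j<k. fps_nth (restrict_to \<phi> ?Q) j = 0"
    using restrict_nth_below ge by auto
  have "enat k \<le> diff_value \<phi> \<omega>" using nu_E_form_le_diff_value[of \<omega>] assms(1) by simp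
  then have "enat (Suc k) \<le> diff_value \<phi> \<omega>" using assms(3) by (metis Suc_ile_eq order_less_le)
  then have "fps_nth (log_pullback \<phi> \<omega>) k = 0" by (simp add: diff_value_def fps_order_ge_iff)
  moreover have "fps_nth (log_pullback \<phi> \<omega>) k = of_nat n * (coeff2 ?P a b * c) + of_nat m * (coeff2 ?Q a b * c)"
    unfolding gh(3) using below by (simp add: fps_mult_nth_lowest gh(1,2) P Q)
  ultimately have "(of_nat n * coeff2 ?P a b + of_nat m * coeff2 ?Q a b) * c = 0"
    by (simp add: algebra_simps)
  then have "of_nat n * coeff2 ?P a b + of_nat m * coeff2 ?Q a b = 0" using c by simp
  then have nz: "coeff2 ?P a b \<noteq> 0" "coeff2 ?Q a b \<noteq> 0" using ab(2) n_pos m_pos by auto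
  show "fps_order (restrict_to \<phi> ?Q) = enat k"
    using Q nz c below by (simp add: fps_order_eq_iff)
  have "a \<noteq> 0" "b \<noteq> 0"
    using nz by (auto simp: coeff2_coord_x_mult coeff2_coord_y_mult split: if_splits)
  then obtain a' b' where "a = Suc a'" "b = Suc b'" by (metis not0_implies_Suc)
  then have "k = n + m + (n * a' + m * b')" using ab(1) by simp
  then show "\<exists>e\<in>Gamma n m. k = n + m + e" using GammaI by blast
qed

text \<open>Cramer's rule: eliminating dy between the two pull-backs leaves the derivative of x
  times the wedge coefficient. The extra factors t and y make the right-hand side consist of values
  and of the terms controlled by \<open>resonant\<close>.\<close>

lemma wedge_identity:
  "(fps_X * fps_deriv (fst \<phi>) * snd \<phi>) * restrict_to \<phi> (form_wedge \<omega> \<eta>) =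
    restrict_to \<phi> (coord_y * snd \<eta>) * log_pullback \<phi> \<omega> -
    restrict_to \<phi> (coord_y * snd \<omega>) * log_pullback \<phi> \<eta>"
  by (simp add: form_wedge_def log_pullback_def restrict_mult restrict_diff restrict_coord_y algebra_simps)

lemma order_wedge_factor: "fps_order (fps_X * fps_deriv (fst \<phi>) * snd \<phi>) = enat (n + m)"
proof -
  obtain g where g: "fps_X * fps_deriv (fst \<phi>) = fst \<phi> * g" "fps_nth g 0 = of_nat n"
    using fps_X_mult_deriv_factor[OF order_x n_pos x_neq_0] .
  have "fps_order (fst \<phi>) = enat n" "fps_order (snd \<phi>) = enat m"
    using x_neq_0 y_neq_0 order_x order_y by (simp_all add: fps_order_def)
  moreover have "fps_order g = enat 0" using g(2) n_pos by (simp add: fps_order_eq_iff)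
  ultimately show ?thesis unfolding g(1) fps_order_mult by simp
qed

text \<open>By resonance the second product in \<open>wedge_identity\<close> has order exactly t +
  v, and the first has order at least the weight of \<eta> plus the value of \<omega>. Hypothesis
  \<open>less\<close> makes the second one dominate.\<close>

lemma wedge_order:
  assumes "nu_E_form n m \<omega> = enat t" "t < n * m" "diff_value \<phi> \<omega> \<noteq> enat t"
    and "diff_value \<phi> \<eta> = enat v"
    and less: "enat (t + v) < nu_E_form n m \<eta> + diff_value \<phi> \<omega>"
  obtains e where "t + v = n + m + e" "fps_order (restrict_to \<phi> (form_wedge \<omega> \<eta>)) = enat e"
proof -
  let ?A = "restrict_to \<phi> (coord_y * snd \<eta>) * log_pullback \<phi> \<omega>"
    and ?B = "restrict_to \<phi> (coord_y * snd \<omega>) * log_pullback \<phi> \<eta>"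
  have B: "fps_order ?B = enat (t + v)"
    using resonant(1)[OF assms(1-3)] assms(4) by (simp add: fps_order_mult diff_value_def)
  have "nu_E_form n m \<eta> \<le> fps_order (restrict_to \<phi> (coord_y * snd \<eta>))"
    using restrict_order_ge[of "coord_y * snd \<eta>"] by (simp add: nu_E_form_def min.coboundedI2)
  then have "nu_E_form n m \<eta> + diff_value \<phi> \<omega> \<le> fps_order ?A"
    by (simp add: fps_order_mult diff_value_def add_right_mono)
  then have "fps_order ?B < fps_order ?A" using less B by simp
  then have "fps_order (?A - ?B) = enat (t + v)" using fps_order_diff_eq B by simp
  then have eq: "enat (n + m) + fps_order (restrict_to \<phi> (form_wedge \<omega> \<eta>)) = enat (t + v)"
    unfolding wedge_identity[symmetric]
      fps_order_mult[of _ "restrict_to \<phi> (form_wedge \<omega> \<eta>)"] order_wedge_factor .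
  then obtain e where e: "fps_order (restrict_to \<phi> (form_wedge \<omega> \<eta>)) = enat e"
    by (cases "fps_order (restrict_to \<phi> (form_wedge \<omega> \<eta>))") auto
  then show ?thesis using that eq by simp
qed

text \<open>The first product in \<open>wedge_identity\<close> vanishes, so the second alone gives
  the order: no comparison enters, and infinite values are covered.\<close>

lemma wedge_order_invariant:
  assumes "nu_E_form n m \<omega> = enat t" "t < n * m" "diff_value \<phi> \<omega> = \<infinity>"
  shows "enat (n + m) + fps_order (restrict_to \<phi> (form_wedge \<omega> \<eta>)) = enat t + diff_value \<phi> \<eta>"
proof -
  have "log_pullback \<phi> \<omega> = 0" using assms(3) by (auto simp: diff_value_def fps_order_def split: if_splits)
  then have "fps_order (fps_X * fps_deriv (fst \<phi>) * snd \<phi> * restrict_to \<phi> (form_wedge \<omega> \<eta>)) =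
      fps_order (- (restrict_to \<phi> (coord_y * snd \<omega>) * log_pullback \<phi> \<eta>))"
    by (simp add: wedge_identity)
  also have "\<dots> = fps_order (restrict_to \<phi> (coord_y * snd \<omega>) * log_pullback \<phi> \<eta>)"
    by (simp add: fps_order_def)
  also have "\<dots> = enat t + diff_value \<phi> \<eta>"
    using resonant(1)[OF assms(1,2)] assms(3) by (simp add: fps_order_mult diff_value_def)
  finally show ?thesis by (simp add: fps_order_mult[of _ "restrict_to \<phi> (form_wedge \<omega> \<eta>)"] order_wedge_factor)
qed

end

lemma Lambda_uptoI: "-1 \<le> j \<Longrightarrow> j \<le> l \<Longrightarrow> lam j + (n * a + m * b) \<in> Lambda_upto n m lam l"
  unfolding Lambda_upto_iff by blast

lemma defect_le:
  assumes nm: "coprime n m" "2 \<le> n" "n < m" and inc: "increasing_upto n m lam l"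
    and "-1 \<le> k" "k \<le> j" "j < l"
  shows "lam k + critical_order n m lam j \<le> lam j + critical_order n m lam k"
proof (cases "1 \<le> j \<and> k < j")
  case True
  then show ?thesis using defect_less[OF nm inc, of j k] assms by simp
next
  case False
  then consider "k = j" | "k = -1" "j = 0" using assms by linarith
  then show ?thesis
    using inc by cases (auto simp: critical_order_0 critical_order_m1 increasing_upto_def)
qed

lemma holomorphic_germ_finite:
  assumes "\<And>\<alpha> \<beta>. coeff2 h \<alpha> \<beta> \<noteq> 0 \<Longrightarrow> \<alpha> \<le> k \<and> \<beta> \<le> k"
  shows "holomorphic_germ h"
  unfolding holomorphic_germ_def
proof (intro exI[of _ 1] conjI)
  have "finite ({..k} \<times> {..k} :: (nat \<times> nat) set)" by simp
  moreover have "{p. (case p of (\<alpha>, \<beta>) \<Rightarrow> norm (coeff2 h \<alpha> \<beta>) * 1 ^ (\<alpha> + \<beta>)) \<noteq> 0} \<subseteq> {..k} \<times> {..k}"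
    using assms by auto
  ultimately have "finite {p \<in> UNIV. (case p of (\<alpha>, \<beta>) \<Rightarrow> norm (coeff2 h \<alpha> \<beta>) * 1 ^ (\<alpha> + \<beta>)) \<noteq> 0}"
    using finite_subset by auto
  then show "(\<lambda>(\<alpha>, \<beta>). norm (coeff2 h \<alpha> \<beta>) * (1 :: real) ^ (\<alpha> + \<beta>)) summable_on UNIV"
    by (rule finite_nonzero_values_imp_summable_on)
qed simp

text \<open>
  Truncation makes any formal form polynomial without changing a given finite value, so convergence
  plays no role in the set of differential values.
\<close>

lemma diff_valuesI:
  assumes "diff_value \<phi> \<omega> = enat k"
  shows "k \<in> diff_values \<phi>"
proof -
  define trunc :: "series2 \<Rightarrow> series2" where
    "trunc h = Abs_fps (\<lambda>\<alpha>. Abs_fps (\<lambda>\<beta>. if \<alpha> \<le> k \<and> \<beta> \<le> k then coeff2 h \<alpha> \<beta> else 0))" for h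
  have co: "coeff2 (trunc h) \<alpha> \<beta> = (if \<alpha> \<le> k \<and> \<beta> \<le> k then coeff2 h \<alpha> \<beta> else 0)" for h \<alpha> \<beta>
    by (simp add: trunc_def coeff2_def)
  have eq: "fps_nth (restrict_to \<phi> (trunc h)) j = fps_nth (restrict_to \<phi> h) j" if "j \<le> k" for h j
    unfolding restrict_to_def fps_nth_Abs_fps using that by (intro sum.cong refl) (simp add: co)
  have "fps_nth (log_pullback \<phi> (trunc (fst \<omega>), trunc (snd \<omega>))) j = fps_nth (log_pullback \<phi> \<omega>) j"
    if "j \<le> k" for j
    using that by (simp add: log_pullback_def fps_mult_nth eq)
  then have "diff_value \<phi> (trunc (fst \<omega>), trunc (snd \<omega>)) = enat k"
    using assms unfolding diff_value_def fps_order_eq_iff by simp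
  moreover have "holomorphic_germ (trunc h)" for h
    by (rule holomorphic_germ_finite[of _ k]) (auto simp: co split: if_splits)
  ultimately show ?thesis unfolding diff_values_def holomorphic_form_def by fastforce
qed

lemma nu_E_form_in_Gamma: "nu_E_form n m \<omega> = enat k \<Longrightarrow> k \<in> Gamma n m"
proof -
  assume "nu_E_form n m \<omega> = enat k"
  then have "nu_E n m (coord_x * fst \<omega>) = enat k \<or> nu_E n m (coord_y * snd \<omega>) = enat k"
    by (auto simp: nu_E_form_def min_def split: if_splits)
  then show ?thesis unfolding nu_E_eq_iff using GammaI by blast
qed

lemma diff_value_neq_0: "diff_value \<phi> \<omega> \<noteq> enat 0"
  by (simp add: diff_value_def fps_order_eq_iff log_pullback_def)

section \<open>Weights and values of forms whose value is new\<close>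

context cusp_orders
begin

text \<open>Hypothesis \<open>less\<close> says that the defect of \<eta>, value minus weight,
  exceeds the defect of every earlier form. Hence the wedge product of \<eta> with \<omega>_j has
  order lam j + e, and e lies in the dual semimodule. For j = -1, 0 both lam j and e are themselves
  in \<open>Gamma\<close>.\<close>

lemma wedge_values_Gamma:
  assumes inc: "increasing_upto n m lam l"
    and forms: "\<forall>j\<in>{1..<l}. nu_E_form n m (\<omega> j) = enat (critical_order n m lam j) \<and>
      diff_value \<phi> (\<omega> j) = enat (lam j)"
    and \<eta>: "nu_E_form n m \<eta> = enat (n + m + e)" "n + m + e < n * m" "diff_value \<phi> \<eta> = enat v"
      "e \<in> Gamma n m" "v \<noteq> n + m + e"
    and less: "\<forall>j\<in>{-1..<l}. n + m + e + lam j < v + critical_order n m lam j"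
    and z: "z \<in> Lambda_upto n m lam (l - 1)"
  shows "z + e \<in> Gamma n m"
proof -
  obtain j a b where j: "-1 \<le> j" "j \<le> l - 1" "z = lam j + (n * a + m * b)"
    using z Lambda_upto_iff by metis
  have "lam j + e \<in> Gamma n m"
  proof (cases "1 \<le> j")
    case True
    then have "nu_E_form n m (\<omega> j) = enat (critical_order n m lam j)" "diff_value \<phi> (\<omega> j) = enat (lam j)"
      using forms j by simp_all
    moreover have "enat (n + m + e + lam j) < enat (critical_order n m lam j) + enat v"
      using less j by (simp add: add.commute)
    ultimately obtain e' where e': "n + m + e + lam j = n + m + e'"
      "fps_order (restrict_to \<phi> (form_wedge \<eta> (\<omega> j))) = enat e'"
      using wedge_order[OF \<eta>(1,2), of "\<omega> j" "lam j"] \<eta>(3,5) by auto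
    then show ?thesis using restrict_order_Gamma by (simp add: add.commute)
  next
    case False
    then have "j = -1 \<or> j = 0" using j by linarith
    then have "lam j = n * 1 \<or> lam j = m * 1" using inc by (auto simp: increasing_upto_def)
    then show ?thesis using Gamma_left[of n 1 m] Gamma_right[of m 1 n] \<eta>(4) Gamma_add by metis
  qed
  then have "lam j + e + (n * a + m * b) \<in> Gamma n m" using Gamma_add GammaI by blast
  then show ?thesis using j by (simp add: ac_simps)
qed

text \<open>The induction on l carries along that the defect v - k of \<eta> exceeds all defects lam
  j - t_j with j < l. Through \<open>wedge_values_Gamma\<close> this puts e in the dual semimodule,
  whose least element bounds k from below; the defect of l - 1 then turns the bound on k into one on
  v.\<close>

lemma new_value_bounds:
  assumes l: "1 \<le> l" and inc: "increasing_upto n m lam l"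
    and forms: "\<forall>j\<in>{1..<l}. nu_E_form n m (\<omega> j) = enat (critical_order n m lam j) \<and>
      diff_value \<phi> (\<omega> j) = enat (lam j)"
    and \<eta>: "diff_value \<phi> \<eta> = enat v" "v \<notin> Lambda_upto n m lam (l - 1)"
  shows "\<exists>k. nu_E_form n m \<eta> = enat k \<and> critical_order n m lam l \<le> k \<and> axis n m lam l < v"
proof -
  let ?t = "critical_order n m lam" and ?u = "axis n m lam" and ?L = "Lambda_upto n m lam"
  \<comment> \<open>Nonzero elements of \<open>Gamma\<close> lie in n + \<open>Gamma\<close> or m +
    \<open>Gamma\<close>, and the value 0 is excluded by the factor t in
    \<open>log_pullback\<close>.\<close>
  have vG: "v \<notin> Gamma n m"
  proof
    assume "v \<in> Gamma n m"
    then obtain a b where ab: "v = n * a + m * b" unfolding Gamma_def by blast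
    have "v \<noteq> 0" using \<eta>(1) diff_value_neq_0 by metis
    then consider a' where "a = Suc a'" | b' where "b = Suc b'"
      using ab by (cases a; cases b) auto
    then show False
    proof cases
      case 1
      then have "v = lam (-1) + (n * a' + m * b)" using ab inc by (simp add: increasing_upto_def)
      then show False using \<eta>(2) l Lambda_uptoI[of "-1" "l - 1"] by simp
    next
      case 2
      then have "v = lam 0 + (n * a + m * b')" using ab inc by (simp add: increasing_upto_def)
      then show False using \<eta>(2) l Lambda_uptoI[of 0 "l - 1"] by simp
    qed
  qed
  have vnm: "v < n * m" using vG Gamma_ge[OF coprime_nm n_pos] by (meson not_le)
  obtain k where k: "nu_E_form n m \<eta> = enat k" "k \<le> v"
    using nu_E_form_le_diff_value[of \<eta>] \<eta>(1) by (cases "nu_E_form n m \<eta>") auto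
  have kv: "v \<noteq> k" using nu_E_form_in_Gamma[OF k(1)] vG by blast
  obtain e where e: "e \<in> Gamma n m" "k = n + m + e"
    using resonant(2)[OF k(1)] k(2) vnm kv \<eta>(1) by auto
  have knm: "k < n * m" using k vnm by simp
  have main: "?t l \<le> k \<and> ?u l < v \<and> (\<forall>j\<in>{-1..<l}. k + lam j < v + ?t j)"
    using l inc forms \<eta>(2)
  proof (induction l rule: int_ge_induct)
    case base
    have lam: "lam (-1) = n" "lam 0 = m" using base by (simp_all add: increasing_upto_def)
    have less: "\<forall>j\<in>{-1..<1}. k + lam j < v + ?t j"
    proof
      fix j :: int assume "j \<in> {-1..<1}"
      then have "j = -1 \<or> j = 0" by auto
      then show "k + lam j < v + ?t j" using lam k kv by (auto simp: critical_order_0 critical_order_m1)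
    qed
    have reg: "regular_at n m lam 1" using regular_at_1[OF coprime_nm n_ge n_less_m lam] .
    have "\<forall>z\<in>?L (1 - 1). z + e \<in> Gamma n m"
      using wedge_values_Gamma[OF base(1,2) k(1)[unfolded e] knm[unfolded e] \<eta>(1) e(1) kv[unfolded e]
          less[unfolded e]] by simp
    then have "?t 1 \<le> k" using reg e unfolding regular_at_def corner_of_def by fastforce
    moreover have "?u 1 < v"
    proof -
      have "?t 1 + lam 0 = ?t 0 + ?u 1" using reg by (simp add: regular_at_def)
      moreover have "k + lam 0 < v + ?t 0" using less by simp
      ultimately show ?thesis using \<open>?t 1 \<le> k\<close> by linarith
    qed
    ultimately show ?case using less by simp
  next
    case (step l)
    have inc: "increasing_upto n m lam l" using step by (simp add: increasing_upto_def)
    have vL1: "v \<notin> ?L l" using step by simp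
    then have vL: "v \<notin> ?L (l - 1)" using Lambda_upto_mono[of "l - 1" l n m lam] by auto
    have IH: "?t l \<le> k" "?u l < v" "\<forall>j\<in>{-1..<l}. k + lam j < v + ?t j"
      using step inc vL by auto
    have reg: "regular_at n m lam l" using regular_at[OF coprime_nm n_ge n_less_m step(1) inc] .
    have reg': "regular_at n m lam (l + 1)"
      using regular_at[OF coprime_nm n_ge n_less_m _ step(3)] step(1) by simp
    define c where "c = ?t l - (n + m)"
    have tc: "?t l = n + m + c" "?t l < n * m" "?t l \<le> ?u l"
      using reg by (simp_all add: c_def regular_at_def)
    have lam: "?u l < lam l" using step by (simp add: increasing_upto_def)
    have form: "nu_E_form n m (\<omega> l) = enat (?t l)" "diff_value \<phi> (\<omega> l) = enat (lam l)"
      using step by simp_all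
    have vc: "v + c \<notin> Gamma n m"
      using reg IH(2) vL unfolding regular_at_def corner_of_def c_def by blast
    \<comment> \<open>If \<omega>_l has the larger defect, the roles are exchanged: its wedge
      product with \<eta> would put v + c in \<open>Gamma\<close>. In a tie the dual condition
      decides: either e = c + g, which puts v in lam l + \<open>Gamma\<close>, or v + c = e + lam l
      reaches n m, beyond which \<open>Gamma\<close> has no gaps.\<close>
    have new: "k + lam l < v + ?t l"
    proof (rule ccontr)
      assume "\<not> ?thesis"
      then consider "v + ?t l < k + lam l" | "v + ?t l = k + lam l" by linarith
      then show False
      proof cases
        case 1
        then have "enat (?t l + v) < nu_E_form n m \<eta> + diff_value \<phi> (\<omega> l)"
          using form(2) k(1) by (simp add: add.commute)
        then obtain e' where "?t l + v = n + m + e'"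
          "fps_order (restrict_to \<phi> (form_wedge (\<omega> l) \<eta>)) = enat e'"
          using wedge_order[OF form(1) tc(2) _ \<eta>(1)] form(2) lam tc(3) by auto
        then show False using vc restrict_order_Gamma tc(1) by (simp add: add.commute)
      next
        case 2
        have "\<forall>z\<in>?L (l - 1). z + e \<in> Gamma n m"
          using wedge_values_Gamma[OF inc _ k(1)[unfolded e] knm[unfolded e] \<eta>(1) e(1) kv[unfolded e]
              IH(3)[unfolded e], of \<omega>] step by simp
        then have "(\<exists>g\<in>Gamma n m. e = c + g) \<or> n * m \<le> e + ?u l"
          using reg e unfolding regular_at_def corner_of_def c_def by blast
        then show False
        proof
          assume "\<exists>g\<in>Gamma n m. e = c + g"
          then obtain g where "g \<in> Gamma n m" "e = c + g" by blast
          then have "v \<in> shifted_Gamma n m (lam l)"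
            using 2 e(2) tc(1) by (auto simp: shifted_Gamma_iff)
          then show False using vL1 Lambda_upto_insert[of l n m lam] step(1) by simp
        next
          assume "n * m \<le> e + ?u l"
          then have "n * m \<le> v + c" using 2 e(2) tc(1) lam by linarith
          then show False using vc Gamma_ge[OF coprime_nm n_pos] by blast
        qed
      qed
    qed
    have less: "\<forall>j\<in>{-1..<l + 1}. k + lam j < v + ?t j"
    proof
      fix j assume "j \<in> {-1..<l + 1}"
      then show "k + lam j < v + ?t j" using IH(3) new by (cases "j = l") auto
    qed
    have "\<forall>z\<in>?L (l + 1 - 1). z + e \<in> Gamma n m"
      using wedge_values_Gamma[OF step(3,4) k(1)[unfolded e] knm[unfolded e] \<eta>(1) e(1) kv[unfolded e]
          less[unfolded e]] by simp
    \<comment> \<open>With c and u now taken at l + 1, both alternatives of the dual condition give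
      c <= e, the second one because c + u <= n m.\<close>
    then have tk: "?t (l + 1) \<le> k" using reg' e unfolding regular_at_def corner_of_def by fastforce
    have "?t (l + 1) + lam l = ?t l + ?u (l + 1)" using reg' by (simp add: regular_at_def)
    then have "?u (l + 1) < v" using tk new by linarith
    then show ?case using less tk by simp
  qed
  then show ?thesis using k by blast
qed

section \<open>Forms of critical weight and the weights of a standard basis\<close>

lemma cancel_leading:
  assumes "diff_value \<phi> \<omega> = enat v" "diff_value \<phi> \<eta> = enat k" "v = k + (n * a + m * b)"
  obtains c where "c \<noteq> 0" "enat v < diff_value \<phi> (form_diff \<omega> (form_scale (monomial2 c a b) \<eta>))"
proof -
  define A where "A = log_pullback \<phi> \<omega>"
  define B where "B = log_pullback \<phi> (form_scale (monomial2 1 a b) \<eta>)"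
  have "fps_order B = enat v"
    using diff_value_scale[of 1 a b \<eta>] assms by (simp add: B_def diff_value_def add.commute)
  moreover have "fps_order A = enat v" using assms(1) by (simp add: A_def diff_value_def)
  ultimately have AB: "fps_nth A v \<noteq> 0" "fps_nth B v \<noteq> 0" "\<forall>j<v. fps_nth A j = 0 \<and> fps_nth B j = 0"
    unfolding fps_order_eq_iff by auto
  define c where "c = fps_nth A v / fps_nth B v"
  have "log_pullback \<phi> (form_scale (monomial2 c a b) \<eta>) = fps_const c * B"
    by (simp add: B_def log_pullback_scale restrict_monomial2 mult.assoc)
  then have "log_pullback \<phi> (form_diff \<omega> (form_scale (monomial2 c a b) \<eta>)) = A - fps_const c * B"
    by (simp add: log_pullback_diff A_def)
  then have "enat (Suc v) \<le> diff_value \<phi> (form_diff \<omega> (form_scale (monomial2 c a b) \<eta>))"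
    unfolding diff_value_def fps_order_ge_iff using AB by (auto simp: less_Suc_eq c_def)
  then have "enat v < diff_value \<phi> (form_diff \<omega> (form_scale (monomial2 c a b) \<eta>))"
    by (simp add: Suc_ile_eq)
  moreover have "c \<noteq> 0" using AB by (simp add: c_def)
  ultimately show ?thesis using that by blast
qed

end

lemma nu_E_0: "nu_E n m 0 = \<infinity>"
  by (simp add: nu_E_def coeff2_def top_enat_def[symmetric])

lemma nu_E_form_dx: "nu_E_form n m form_dx = enat n"
proof -
  have "nu_E n m coord_x = enat n"
    unfolding nu_E_eq_iff
    by (auto simp: coeff2_def coord_x_def intro!: exI[of _ 1] exI[of _ 0])
  then show ?thesis by (simp add: nu_E_form_def form_dx_def nu_E_0)
qed

lemma nu_E_form_dy: "nu_E_form n m form_dy = enat m"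
proof -
  have "nu_E n m coord_y = enat m"
    unfolding nu_E_eq_iff
    by (auto simp: coeff2_def coord_y_def intro!: exI[of _ 1] exI[of _ 0])
  then show ?thesis by (simp add: nu_E_form_def form_dy_def nu_E_0)
qed

context cusp_orders
begin

lemma restrict_1: "restrict_to \<phi> 1 = 1"
proof -
  have "(1 :: series2) = monomial2 1 0 0" by (auto simp: monomial2_def fps_eq_iff)
  then show ?thesis using restrict_monomial2[of 1 0 0] by simp
qed

lemma restrict_0: "restrict_to \<phi> 0 = 0"
  using restrict_diff[of 0 0] by simp

lemma diff_value_dx: "diff_value \<phi> form_dx = enat n"
proof -
  obtain g where "fps_X * fps_deriv (fst \<phi>) = fst \<phi> * g" "fps_nth g 0 = of_nat n"
    using fps_X_mult_deriv_factor[OF order_x n_pos x_neq_0] .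
  then show ?thesis
    using n_pos x_neq_0 order_x
    by (auto simp: diff_value_def log_pullback_def form_dx_def restrict_1 restrict_0 fps_order_def)
qed

lemma diff_value_dy: "diff_value \<phi> form_dy = enat m"
proof -
  obtain g where "fps_X * fps_deriv (snd \<phi>) = snd \<phi> * g" "fps_nth g 0 = of_nat m"
    using fps_X_mult_deriv_factor[OF order_y m_pos y_neq_0] .
  then show ?thesis
    using m_pos y_neq_0 order_y
    by (auto simp: diff_value_def log_pullback_def form_dy_def restrict_1 restrict_0 fps_order_def)
qed

end

context cusp_orders
begin

text \<open>
  The two forms of value \<open>u\<^sub>l\<close> whose leading coefficients are cancelled are the multiples of
  \<open>\<omega>\<^bsub>l-1\<^esub>\<close> and of an earlier form which witness that \<open>u\<^sub>l\<close> is an axis.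
\<close>

lemma ex_critical_form:
  assumes l: "1 \<le> l" and inc: "increasing_upto n m lam l"
    and dx: "\<omega> (-1) = form_dx" and dy: "\<omega> 0 = form_dy"
    and forms: "\<forall>j\<in>{-1..<l}. nu_E_form n m (\<omega> j) = enat (critical_order n m lam j) \<and>
      diff_value \<phi> (\<omega> j) = enat (lam j)"
  shows "\<exists>\<theta>. nu_E_form n m \<theta> = enat (critical_order n m lam l) \<and>
    enat (axis n m lam l) < diff_value \<phi> \<theta>"
proof -
  let ?t = "critical_order n m lam" and ?u = "axis n m lam"
  have reg: "regular_at n m lam l" using regular_at[OF coprime_nm n_ge n_less_m l inc] .
  then have tu: "?t l + lam (l - 1) = ?t (l - 1) + ?u l" by (simp add: regular_at_def)
  obtain a b where ab: "?u l = lam (l - 1) + (n * a + m * b)"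
    using reg unfolding regular_at_def shifted_Gamma_iff Gamma_def by blast
  obtain k a' b' where k: "-1 \<le> k" "k \<le> l - 2" "?u l = lam k + (n * a' + m * b')"
    using reg unfolding regular_at_def Lambda_upto_iff by blast
  define F where "F = form_scale (monomial2 1 a b) (\<omega> (l - 1))"
  have F: "nu_E_form n m F = enat (?t l)" "diff_value \<phi> F = enat (?u l)"
    using forms l ab tu by (simp_all add: F_def nu_E_form_scale diff_value_scale)
  have k_val: "diff_value \<phi> (\<omega> k) = enat (lam k)" using forms k by simp
  obtain c where c: "c \<noteq> 0"
    "enat (?u l) < diff_value \<phi> (form_diff F (form_scale (monomial2 c a' b') (\<omega> k)))"
    using cancel_leading[OF F(2) k_val k(3)] by blast
  define G where "G = form_scale (monomial2 c a' b') (\<omega> k)"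
  have G: "nu_E_form n m G = enat (n * a' + m * b' + ?t k)"
    using forms k c(1) by (simp add: G_def nu_E_form_scale)
  have "nu_E_form n m (form_diff F G) = enat (?t l)"
  proof (cases "l = 1")
    case False
    then have "lam k + ?t (l - 1) < lam (l - 1) + ?t k"
      using defect_less[OF coprime_nm n_ge n_less_m inc, of "l - 1" k] l k by simp
    then have "?t l < n * a' + m * b' + ?t k" using tu k(3) by linarith
    then show ?thesis using nu_E_form_diff_eq[OF F(1)] G by simp
  next
    case True
    then have k': "k = -1" using k by simp
    \<comment> \<open>At l = 1 the defects of dx and dy agree, so F and G may have the same weight.
      Nothing cancels all the same, since F is a multiple of dy and G of dx.\<close>
    have "fst F = 0" "snd G = 0"
      using True k' dx dy by (simp_all add: F_def G_def form_scale_def form_dx_def form_dy_def)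
    then have "nu_E n m (coord_y * snd (form_diff F G)) = enat (?t l)"
      using F(1) by (simp add: form_diff_def nu_E_form_def nu_E_0)
    then have "nu_E_form n m (form_diff F G) \<le> enat (?t l)" by (simp add: nu_E_form_def)
    moreover have "?t l \<le> n * a' + m * b' + ?t k"
      using tu k(3) True k' inc by (simp add: increasing_upto_def critical_order_0 critical_order_m1)
    then have "enat (?t l) \<le> nu_E_form n m (form_diff F G)"
      using nu_E_form_diff_ge[of "?t l" n m F G] F(1) G by simp
    ultimately show ?thesis by simp
  qed
  then show ?thesis using c(2) G_def by blast
qed

text \<open>A value N below lam l lies in lam j + \<open>Gamma\<close> for some j < l, so a monomial
  multiple of \<omega>_j cancels the leading coefficient. That multiple has weight above t_l,
  because N > u_l and the defect of j is at most that of l - 1; thus the weight t_l survives each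
  correction.\<close>

lemma ex_critical_form_value_ge:
  assumes l: "1 \<le> l" "l \<le> s" and inc: "increasing_upto n m lam l"
    and basis: "semimodule_basis n m (diff_values \<phi>) lam s"
    and dx: "\<omega> (-1) = form_dx" and dy: "\<omega> 0 = form_dy"
    and forms: "\<forall>j\<in>{-1..<l}. nu_E_form n m (\<omega> j) = enat (critical_order n m lam j) \<and>
      diff_value \<phi> (\<omega> j) = enat (lam j)"
    and N: "axis n m lam l < N" "N \<le> lam l"
  shows "\<exists>\<theta>. nu_E_form n m \<theta> = enat (critical_order n m lam l) \<and> enat N \<le> diff_value \<phi> \<theta>"
  using N(1)[folded Suc_le_eq] N(2)
proof (induction N rule: dec_induct)
  case base
  then show ?case using ex_critical_form[OF l(1) inc dx dy forms] by (simp add: Suc_ile_eq)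
next
  case (step N)
  let ?t = "critical_order n m lam" and ?u = "axis n m lam"
  obtain \<theta> where \<theta>: "nu_E_form n m \<theta> = enat (?t l)" "enat N \<le> diff_value \<phi> \<theta>"
    using step by auto
  show ?case
  proof (cases "diff_value \<phi> \<theta> = enat N")
    case False
    then show ?thesis using \<theta> by (metis Suc_ile_eq order_less_le)
  next
    case True
    then have "N \<in> Lambda_upto n m lam s"
      using diff_valuesI basis by (metis semimodule_basis_def)
    then obtain j a b where j: "-1 \<le> j" "j \<le> s" "N = lam j + (n * a + m * b)"
      unfolding Lambda_upto_iff by blast
    have "j < l"
    proof (rule ccontr)
      assume "\<not> j < l"
      then have "lam l \<le> lam j"
        using basis l j strict_mono_on_leD[of "{-1..s}" lam l j] by (auto simp: semimodule_basis_def)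
      then show False using j(3) step by simp
    qed
    have tj: "nu_E_form n m (\<omega> j) = enat (?t j)" "diff_value \<phi> (\<omega> j) = enat (lam j)"
      using forms j(1) \<open>j < l\<close> by simp_all
    obtain c where c: "c \<noteq> 0"
      "enat N < diff_value \<phi> (form_diff \<theta> (form_scale (monomial2 c a b) (\<omega> j)))"
      using cancel_leading[OF True tj(2) j(3)] by blast
    have "lam j + ?t (l - 1) \<le> lam (l - 1) + ?t j"
      using defect_le[OF coprime_nm n_ge n_less_m inc, of j "l - 1"] j \<open>j < l\<close> by simp
    moreover have "?t l + lam (l - 1) = ?t (l - 1) + ?u l"
      using regular_at[OF coprime_nm n_ge n_less_m l(1) inc] by (simp add: regular_at_def)
    ultimately have "?t l < n * a + m * b + ?t j" using j(3) step by linarith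
    then have "nu_E_form n m (form_diff \<theta> (form_scale (monomial2 c a b) (\<omega> j))) = enat (?t l)"
      using nu_E_form_diff_eq[OF \<theta>(1)] tj(1) c(1) by (simp add: nu_E_form_scale)
    then show ?thesis using c(2) unfolding Suc_ile_eq by blast
  qed
qed

text \<open>\<open>new_value_bounds\<close> gives weight at least t_l. Were it larger, the wedge
  product of \<omega>_l with a form of weight t_l and value at least lam l would have a known order,
  putting lam l + c in \<open>Gamma\<close>; this contradicts the corner property, as lam l is new
  and exceeds u_l.\<close>

lemma standard_basis_weights:
  assumes basis: "semimodule_basis n m (diff_values \<phi>) lam s"
    and forms: "\<forall>j\<in>{-1..s}. diff_value \<phi> (\<omega> j) = enat (lam j)"
    and dx: "\<omega> (-1) = form_dx" and dy: "\<omega> 0 = form_dy" and s: "0 \<le> s"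
    and l: "1 \<le> l" "l \<le> s + 1"
  shows "increasing_upto n m lam l \<and>
    (\<forall>j\<in>{-1..<l}. nu_E_form n m (\<omega> j) = enat (critical_order n m lam j))"
  using l
proof (induction l rule: int_ge_induct)
  case base
  have "diff_value \<phi> (\<omega> (-1)) = enat (lam (-1))" "diff_value \<phi> (\<omega> 0) = enat (lam 0)"
    using forms s by simp_all
  then have "lam (-1) = n" "lam 0 = m" by (simp_all add: dx dy diff_value_dx diff_value_dy)
  moreover have "{-1..<1} = {-1, 0 :: int}" by auto
  ultimately show ?case using dx dy
    by (simp add: increasing_upto_def critical_order_0 critical_order_m1 nu_E_form_dx nu_E_form_dy)
next
  case (step l)
  let ?t = "critical_order n m lam" and ?u = "axis n m lam" and ?L = "Lambda_upto n m lam"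
  have inc: "increasing_upto n m lam l"
    and w: "\<forall>j\<in>{-1..<l}. nu_E_form n m (\<omega> j) = enat (?t j) \<and> diff_value \<phi> (\<omega> j) = enat (lam j)"
    using step forms by auto
  have val: "diff_value \<phi> (\<omega> l) = enat (lam l)" using forms step by simp
  have new: "lam l \<notin> ?L (l - 1)" using basis step by (simp add: semimodule_basis_def)
  obtain k where k: "nu_E_form n m (\<omega> l) = enat k" "?t l \<le> k" "?u l < lam l"
    using new_value_bounds[OF step(1) inc _ val new, of \<omega>] w by auto
  have reg: "regular_at n m lam l" using regular_at[OF coprime_nm n_ge n_less_m step(1) inc] .
  have "k = ?t l"
  proof (rule ccontr)
    assume "k \<noteq> ?t l"
    then have less: "?t l < k" using k by simp
    obtain \<theta> where \<theta>: "nu_E_form n m \<theta> = enat (?t l)" "enat (lam l) \<le> diff_value \<phi> \<theta>"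
      using ex_critical_form_value_ge[OF step(1) _ inc basis dx dy w k(3) order_refl] step by auto
    have "?t l < lam l" using k(3) reg by (simp add: regular_at_def)
    then have neq: "diff_value \<phi> \<theta> \<noteq> enat (?t l)" using \<theta>(2) by auto
    have "enat (?t l + lam l) < enat (k + lam l)" using less by simp
    also have "\<dots> \<le> nu_E_form n m (\<omega> l) + diff_value \<phi> \<theta>"
      using k(1) \<theta>(2) by (simp flip: plus_enat_simps(1) add: add_left_mono)
    finally obtain e where e: "?t l + lam l = n + m + e"
      "fps_order (restrict_to \<phi> (form_wedge \<theta> (\<omega> l))) = enat e"
      using wedge_order[OF \<theta>(1) _ neq val] reg by (auto simp: regular_at_def)
    have "lam l + (?t l - (n + m)) = e" using e(1) reg by (simp add: regular_at_def)
    then have "lam l + (?t l - (n + m)) \<in> Gamma n m" using restrict_order_Gamma e(2) by simp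
    then show False using reg new k(3) unfolding regular_at_def corner_of_def by blast
  qed
  then have "\<forall>j\<in>{-1..<l + 1}. nu_E_form n m (\<omega> j) = enat (?t j)"
    using w k(1) by (auto simp: less_le)
  moreover have "increasing_upto n m lam (l + 1)"
    using inc new k(3) by (auto simp: increasing_upto_def less_le)
  ultimately show ?case by simp
qed

end

text \<open>
  The wedge product of \<open>\<omega>\<^sub>i\<close> with an earlier form has value less than \<open>n * m\<close> on \<open>C\<close>, hence the
  same value on every cusp; on a cusp invariant by \<open>\<omega>\<^sub>i\<close> it computes the value of the earlier form.
\<close>

lemma invariant_cusp_values:
  assumes C: "cusp_orders n m C" and D: "cusp_orders n m D"
    and basis: "semimodule_basis n m (diff_values C) lam s"
    and forms: "\<forall>j\<in>{-1..s}. diff_value C (\<omega> j) = enat (lam j)"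
    and dx: "\<omega> (-1) = form_dx" and dy: "\<omega> 0 = form_dy"
    and last: "nu_E_form n m (\<omega> (s + 1)) = enat (critical_order n m lam (s + 1))"
      "diff_value C (\<omega> (s + 1)) = \<infinity>"
    and i: "1 \<le> i" "i \<le> s + 1" and inv: "diff_value D (\<omega> i) = \<infinity>"
  shows "nu_E_form n m (\<omega> i) = enat (critical_order n m lam i)"
    and "\<forall>j\<in>{-1..i - 1}. diff_value D (\<omega> j) = enat (lam j)"
    and "diff_values D = Lambda_upto n m lam (i - 1)"
proof -
  interpret C: cusp_orders n m C by (rule C)
  interpret D: cusp_orders n m D by (rule D)
  let ?t = "critical_order n m lam" and ?u = "axis n m lam" and ?L = "Lambda_upto n m lam"
  note nm = C.coprime_nm C.n_ge C.n_less_m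
  have inc: "increasing_upto n m lam (s + 1)"
    and w: "\<forall>j\<in>{-1..s}. nu_E_form n m (\<omega> j) = enat (?t j)"
    using C.standard_basis_weights[OF basis forms dx dy _ _ order_refl] i by auto
  show wi: "nu_E_form n m (\<omega> i) = enat (?t i)"
    using w last(1) i by (cases "i = s + 1") auto
  have inci: "increasing_upto n m lam i" using inc i by (auto simp: increasing_upto_def)
  have reg: "regular_at n m lam i" using regular_at[OF nm i(1) inci] .
  have tnm: "?t i < n * m" "n + m \<le> ?t i" using reg by (simp_all add: regular_at_def)
  have val: "diff_value D (\<omega> j) = enat (lam j)" if j: "-1 \<le> j" "j < i" for j
  proof -
    have jC: "diff_value C (\<omega> j) = enat (lam j)" "nu_E_form n m (\<omega> j) = enat (?t j)"
      using forms w j i by simp_all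
    have less: "enat (?t i + lam j) < nu_E_form n m (\<omega> j) + diff_value C (\<omega> i)"
      and neq: "diff_value C (\<omega> i) \<noteq> enat (?t i)"
    proof -
      show "enat (?t i + lam j) < nu_E_form n m (\<omega> j) + diff_value C (\<omega> i)"
      proof (cases "i = s + 1")
        case False
        then show ?thesis using defect_less[OF nm inc i(1) _ j] i forms jC by (simp add: add.commute)
      qed (simp add: last)
      show "diff_value C (\<omega> i) \<noteq> enat (?t i)"
      proof (cases "i = s + 1")
        case False
        then have "?u i < lam i" using inc i by (simp add: increasing_upto_def)
        then show ?thesis using False forms i reg by (auto simp: regular_at_def)
      qed (simp add: last)
    qed
    obtain e where e: "?t i + lam j = n + m + e"
      "fps_order (restrict_to C (form_wedge (\<omega> i) (\<omega> j))) = enat e"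
      using C.wedge_order[OF wi tnm(1) neq jC(1) less] by blast
    \<comment> \<open>With c = t_i - n - m, e is c + lam j. Since lam j < u_i, the bound c + u_i <=
      n m puts e below n m.\<close>
    have "?t i - (n + m) + ?u i \<le> n * m" using reg unfolding regular_at_def corner_of_def by blast
    moreover have "lam j < ?u i"
    proof -
      have "lam (i - 1) < ?u i"
      proof -
        have "lam (i - 1) \<le> ?u i" using reg by (auto simp: regular_at_def shifted_Gamma_iff)
        moreover have "lam (i - 1) \<notin> ?L (i - 2)"
        proof -
          have "\<forall>j\<in>{0..s}. lam j \<notin> ?L (j - 1)" using basis by (simp add: semimodule_basis_def)
          moreover have "i - 1 \<in> {0..s}" using i by simp
          ultimately have "lam (i - 1) \<notin> ?L (i - 1 - 1)" by blast
          then show ?thesis by simp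
        qed
        moreover have "?u i \<in> ?L (i - 2)" using reg by (simp add: regular_at_def)
        ultimately show ?thesis by (metis order_less_le)
      qed
      moreover have "lam j \<le> lam (i - 1)"
        using basis i j strict_mono_on_leD[of "{-1..s}" lam j "i - 1"] by (auto simp: semimodule_basis_def)
      ultimately show ?thesis by simp
    qed
    ultimately have "e < n * m" using e(1) tnm(2) by linarith
    then have "fps_order (restrict_to D (form_wedge (\<omega> i) (\<omega> j))) = enat e"
      using C.nu_E_eq_restrict_order[OF e(2)] D.restrict_order_eq by blast
    then have "enat (?t i + lam j) = enat (?t i) + diff_value D (\<omega> j)"
      using D.wedge_order_invariant[OF wi tnm(1) inv, of "\<omega> j"] e(1) by simp
    then show ?thesis by (cases "diff_value D (\<omega> j)") auto
  qed
  then show "\<forall>j\<in>{-1..i - 1}. diff_value D (\<omega> j) = enat (lam j)" by simp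
  show "diff_values D = ?L (i - 1)"
  proof (intro set_eqI iffI)
    fix v assume "v \<in> diff_values D"
    then obtain \<eta> where \<eta>: "diff_value D \<eta> = enat v" unfolding diff_values_def by blast
    show "v \<in> ?L (i - 1)"
    proof (rule ccontr)
      assume v: "v \<notin> ?L (i - 1)"
      have "\<forall>j\<in>{1..<i}. nu_E_form n m (\<omega> j) = enat (?t j) \<and> diff_value D (\<omega> j) = enat (lam j)"
        using w val i by auto
      \<comment> \<open>The bound is applied on D instead of C, which is possible because the
        earlier forms have just been given the same values there.\<close>
      then have uv: "?u i < v" using D.new_value_bounds[OF i(1) inci _ \<eta> v, of \<omega>] by blast
      have eq: "enat (n + m) + fps_order (restrict_to D (form_wedge (\<omega> i) \<eta>)) = enat (?t i + v)"
        using D.wedge_order_invariant[OF wi tnm(1) inv, of \<eta>] \<eta> by simp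
      then obtain e where e: "fps_order (restrict_to D (form_wedge (\<omega> i) \<eta>)) = enat e"
        by (cases "fps_order (restrict_to D (form_wedge (\<omega> i) \<eta>))") auto
      then have "v + (?t i - (n + m)) = e" using eq tnm by simp
      then have "v + (?t i - (n + m)) \<in> Gamma n m" using D.restrict_order_Gamma e by simp
      then show False using reg uv v unfolding regular_at_def corner_of_def by blast
    qed
  next
    fix v assume "v \<in> ?L (i - 1)"
    then obtain j a b where j: "-1 \<le> j" "j \<le> i - 1" "v = lam j + (n * a + m * b)"
      unfolding Lambda_upto_iff by blast
    then have "diff_value D (form_scale (monomial2 1 a b) (\<omega> j)) = enat v"
      using val by (simp add: D.diff_value_scale add.commute)
    then show "v \<in> diff_values D" by (rule diff_valuesI)
  qed
qed

subsection \<open>Cuspidal sequences\<close>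

lemma centred_blow_down_path: "centred \<psi> \<Longrightarrow> centred (blow_down_path p \<psi>)"
proof (induction p)
  case (Cons d p)
  obtain u v where uv: "blow_down_path p \<psi> = (u, v)" by fastforce
  then show ?case using Cons by (cases d) (auto simp: centred_def)
qed simp

lemma blow_down_path_append: "blow_down_path (p @ q) \<psi> = blow_down_path p (blow_down_path q \<psi>)"
  by (induction p) auto

text \<open>The strict transform of the first-coordinate-zero axis meets the exceptional divisor
  only at \<open>Vertical\<close>, and it is the same axis in the coordinates there.\<close>

lemma infinitely_near_y_axis: "infinitely_near_point_of p (0, fps_X) \<longleftrightarrow> set p \<subseteq> {Vertical}"
proof (induction p)
  case Nil
  show ?case by (auto simp: infinitely_near_point_of_def strict_transform_at_def centred_def)
next
  case (Cons d p)
  have "blow_down d \<psi> = (0, fps_X) \<longleftrightarrow> d = Vertical \<and> \<psi> = (0, fps_X)" for \<psi>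
    by (cases d; cases \<psi>) auto
  then show ?case using Cons
    by (auto simp: infinitely_near_point_of_def strict_transform_at_def)
qed

lemma infinitely_near_x_axis: "infinitely_near_point_of p (fps_X, 0) \<longleftrightarrow> set p \<subseteq> {Slope 0}"
proof (induction p)
  case Nil
  show ?case by (auto simp: infinitely_near_point_of_def strict_transform_at_def centred_def)
next
  case (Cons d p)
  \<comment> \<open>Centring is essential: without it, the constant v = -c would be a lift in every
    direction \<open>Slope c\<close>.\<close>
  have *: "blow_down d \<psi> = (fps_X, 0) \<longleftrightarrow> d = Slope 0 \<and> \<psi> = (fps_X, 0)" if "centred \<psi>" for \<psi>
  proof (cases d)
    case (Slope c)
    obtain u v where \<psi>: "\<psi> = (u, v)" by fastforce
    have "v + fps_const c = 0 \<Longrightarrow> c = 0"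
      using that \<psi> by (metis add.left_neutral centred_def fps_add_nth fps_nth_fps_const fps_zero_nth snd_conv)
    then show ?thesis using Slope \<psi> by auto
  next
    case Vertical
    then show ?thesis by (cases \<psi>) auto
  qed
  have "infinitely_near_point_of (d # p) (fps_X, 0) \<longleftrightarrow>
      (\<exists>\<psi>. centred \<psi> \<and> d = Slope 0 \<and> blow_down_path p \<psi> = (fps_X, 0))"
    unfolding infinitely_near_point_of_def strict_transform_at_def blow_down_path.simps
    using *[OF centred_blow_down_path] by blast
  also have "\<dots> \<longleftrightarrow> d = Slope 0 \<and> infinitely_near_point_of p (fps_X, 0)"
    unfolding infinitely_near_point_of_def strict_transform_at_def by blast
  finally show ?case using Cons by simp
qed

text \<open>
  The indices of the divisors through \<open>p\<close> that are \<open>u = 0\<close>, respectively \<open>v = 0\<close>, in the coordinates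
  \<open>(u, v)\<close> at \<open>p\<close>; each set has at most one element.
\<close>

definition U_divisors :: "inpoint \<Rightarrow> nat set" where
  "U_divisors p = {j \<in> {1..length p}. p ! (j - 1) \<noteq> Vertical \<and> set (drop j p) \<subseteq> {Vertical}}"

definition V_divisors :: "inpoint \<Rightarrow> nat set" where
  "V_divisors p = {j \<in> {1..length p}. p ! (j - 1) = Vertical \<and> set (drop j p) \<subseteq> {Slope 0}}"

lemma finite_divisors: "finite (U_divisors p)" "finite (V_divisors p)"
  by (simp_all add: U_divisors_def V_divisors_def)

lemma atLeastAtMost_snoc: "{1..length (p @ [d])} = insert (Suc (length p)) {1..length p}"
  by auto

lemma U_divisors_snoc:
  "U_divisors (p @ [Slope c]) = {Suc (length p)}" "U_divisors (p @ [Vertical]) = U_divisors p"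
  unfolding U_divisors_def atLeastAtMost_snoc by (auto simp: nth_append)

lemma V_divisors_snoc:
  "V_divisors (p @ [Slope c]) = (if c = 0 then V_divisors p else {})"
  "V_divisors (p @ [Vertical]) = {Suc (length p)}"
  unfolding V_divisors_def atLeastAtMost_snoc by (auto simp: nth_append)

lemma divisors_Nil: "U_divisors [] = {}" "V_divisors [] = {}"
  by (simp_all add: U_divisors_def V_divisors_def)

lemma nth_prefixes: "k \<le> length p \<Longrightarrow> prefixes p ! k = take k p"
proof (induction p arbitrary: k)
  case (Cons d p)
  then show ?case by (cases k) auto
qed simp

lemma take_prefixes: "k \<le> length p \<Longrightarrow> take k (prefixes p) = map (\<lambda>j. take j p) [0..<k]"
  by (rule nth_equalityI) (auto simp: nth_prefixes)

text \<open>These are the centres that must be blown up for p to appear on the exceptional divisor;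
  \<open>prefixes p\<close> blows up p as well.\<close>

definition proper_prefixes :: "inpoint \<Rightarrow> inpoint list" where
  "proper_prefixes p = map (\<lambda>j. take j p) [0..<length p]"

lemma take_prefixes_proper: "k \<le> length p \<Longrightarrow> take k (prefixes p) = proper_prefixes (take k p)"
  by (simp add: take_prefixes proper_prefixes_def)

lemma proper_prefixes_snoc: "proper_prefixes (p @ [d]) = prefixes p"
  using take_prefixes[of "length p" p]
  by (intro nth_equalityI) (auto simp: proper_prefixes_def nth_prefixes simp del: upt_Suc)

lemma mem_exceptional_points: "p \<in> exceptional_points (proper_prefixes p)"
proof -
  have "q \<in> set (proper_prefixes p)" if "strict_prefix q p" for q
  proof -
    have "q = take (length q) p" "length q < length p"
      using that by (auto simp: strict_prefix_def prefix_def)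
    then show ?thesis unfolding proper_prefixes_def by force
  qed
  moreover have "take j p \<noteq> p" if "j < length p" for j
    using that by (simp add: take_all_iff)
  then have "p \<notin> set (proper_prefixes p)"
    unfolding proper_prefixes_def set_map by (metis atLeastLessThan_iff imageE set_upt)
  ultimately show ?thesis by (simp add: exceptional_points_def)
qed

definition branching :: "inpoint \<Rightarrow> nat" where
  "branching p = card (U_divisors p) + card (V_divisors p)"

text \<open>The j-th divisor is a coordinate axis in the chart of the j-th direction, and it passes
  through p exactly when all later directions stay on this axis. So e(p) can be read off the
  directions.\<close>

lemma e_number_eq: "e_number (proper_prefixes p) p = branching p"
proof -
  have "p \<in> divisor (proper_prefixes p) j \<longleftrightarrow> j \<in> U_divisors p \<or> j \<in> V_divisors p"
    if j: "j \<in> {1..length p}" for j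
  proof -
    have eq: "p = take (j - 1) p @ p ! (j - 1) # drop j p"
    proof -
      have "j - 1 < length p" "Suc (j - 1) = j" using j by auto
      then show ?thesis using id_take_nth_drop[of "j - 1" p] by metis
    qed
    have "p = take (j - 1) p @ d # q \<longleftrightarrow> d = p ! (j - 1) \<and> q = drop j p" for d q
      using eq by (metis list.inject same_append_eq)
    moreover have "proper_prefixes p ! (j - 1) = take (j - 1) p"
    proof -
      have "j - 1 < length p" using j by auto
      then show ?thesis by (simp add: proper_prefixes_def)
    qed
    ultimately have "p \<in> divisor (proper_prefixes p) j \<longleftrightarrow>
        infinitely_near_point_of (drop j p) (exceptional_param (p ! (j - 1)))"
      using mem_exceptional_points by (auto simp: divisor_def)
    then show ?thesis using j
      by (cases "p ! (j - 1)")
        (auto simp: U_divisors_def V_divisors_def infinitely_near_x_axis infinitely_near_y_axis)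
  qed
  then have "{j \<in> {1..length (proper_prefixes p)}. p \<in> divisor (proper_prefixes p) j} = U_divisors p \<union> V_divisors p"
    by (auto simp: proper_prefixes_def U_divisors_def V_divisors_def)
  moreover have "U_divisors p \<inter> V_divisors p = {}" by (auto simp: U_divisors_def V_divisors_def)
  ultimately show ?thesis
    unfolding e_number_def branching_def using finite_divisors by (simp add: card_Un_disjoint)
qed

lemma card_U_divisors: "card (U_divisors p) = (if set p \<subseteq> {Vertical} then 0 else 1)"
proof (induction p rule: rev_induct)
  case (snoc d p)
  then show ?case by (cases d) (auto simp: U_divisors_snoc)
qed (simp add: divisors_Nil)

lemma card_V_divisors_le: "card (V_divisors p) \<le> 1"
proof (induction p rule: rev_induct)
  case (snoc d p)
  then show ?case by (cases d) (auto simp: V_divisors_snoc)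
qed (simp add: divisors_Nil)

lemma card_V_divisors:
  "set p \<subseteq> {Slope 0, Vertical} \<Longrightarrow> card (V_divisors p) = (if set p \<subseteq> {Slope 0} then 0 else 1)"
proof (induction p rule: rev_induct)
  case (snoc d p)
  then show ?case by (cases d) (auto simp: V_divisors_snoc)
qed (simp add: divisors_Nil)

lemma branching_snoc:
  "branching (p @ [Slope c]) = (if c = 0 then 1 + card (V_divisors p) else 1)"
  "branching (p @ [Vertical]) = 1 + card (U_divisors p)"
  by (simp_all add: branching_def U_divisors_snoc V_divisors_snoc)

lemma branching_bounds: "p \<noteq> [] \<Longrightarrow> 1 \<le> branching p \<and> branching p \<le> 2"
proof -
  assume "p \<noteq> []"
  then obtain q d where p: "p = q @ [d]" by (metis append_butlast_last_id)
  show ?thesis unfolding p using card_V_divisors_le[of q]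
    by (cases d) (auto simp: branching_snoc card_U_divisors)
qed

lemma branching_single: "branching [d] = 1"
  using branching_snoc[of "[]"] by (cases d) (auto simp: divisors_Nil)

lemma branching_word:
  assumes "set p \<subseteq> {Slope 0, Vertical}" "p \<noteq> []"
  shows "branching p = (if set p \<subseteq> {Slope 0} \<or> set p \<subseteq> {Vertical} then 1 else 2)"
proof -
  have "\<not> (set p \<subseteq> {Slope 0} \<and> set p \<subseteq> {Vertical})" using assms(2) by (cases p) auto
  then show ?thesis
    using card_V_divisors[OF assms(1)] by (auto simp: branching_def card_U_divisors)
qed

lemma free_point_iff: "free_point (proper_prefixes p) p \<longleftrightarrow> branching p = 1"
  and corner_point_iff: "corner_point (proper_prefixes p) p \<longleftrightarrow> branching p = 2"
  by (simp_all add: free_point_def corner_point_def mem_exceptional_points e_number_eq)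

text \<open>Monotonicity makes the indices of free points an initial segment, nonempty because a
  first point is always free. Its maximum is the unique number described by the definition.\<close>

lemma freeness_index_prefixes:
  assumes "p \<noteq> []"
    and mono: "\<forall>k. 2 \<le> k \<and> k \<le> length p \<longrightarrow> branching (take (k - 1) p) \<le> branching (take k p)"
  defines "f \<equiv> freeness_index (prefixes p)"
  shows "1 \<le> f \<and> f \<le> length p \<and> (\<forall>k. 1 \<le> k \<and> k \<le> f \<longrightarrow> branching (take k p) = 1) \<and>
    (\<forall>k. f + 1 \<le> k \<and> k \<le> length p \<longrightarrow> branching (take k p) = 2)" (is "?P f")
proof -
  have mono': "branching (take j p) \<le> branching (take k p)" if "1 \<le> j" "j \<le> k" "k \<le> length p" for j k
    using that(2,3)
  proof (induction k rule: dec_induct)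
    case (step k)
    then show ?case using mono[rule_format, of "Suc k"] that(1) by auto
  qed simp
  have bounds: "1 \<le> branching (take k p) \<and> branching (take k p) \<le> 2" if "1 \<le> k" for k
    using branching_bounds[of "take k p"] assms(1) that by simp
  define S where "S = {k \<in> {1..length p}. branching (take k p) = 1}"
  have "take 1 p = [hd p]" using assms(1) by (cases p) auto
  then have "1 \<in> S" using assms(1) branching_single by (cases p) (auto simp: S_def)
  moreover have "finite S" by (simp add: S_def)
  ultimately have g: "Max S \<in> S" "\<forall>k\<in>S. k \<le> Max S" using Max_in by fastforce+
  have ex: "?P (Max S)"
  proof (intro conjI allI impI)
    show "1 \<le> Max S" "Max S \<le> length p" using g by (auto simp: S_def)
    show "branching (take k p) = 1" if "1 \<le> k \<and> k \<le> Max S" for k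
      using mono'[of k "Max S"] bounds[of k] that g(1) by (auto simp: S_def)
    show "branching (take k p) = 2" if "Max S + 1 \<le> k \<and> k \<le> length p" for k
    proof -
      have "k \<notin> S" "1 \<le> k" using g(2) that by auto
      then show ?thesis using bounds[of k] that by (auto simp: S_def)
    qed
  qed
  have unique: "h = Max S" if "?P h" for h
  proof (rule antisym)
    show "h \<le> Max S" using that ex by (metis Suc_eq_plus1 not_less_eq_eq numeral_eq_one_iff semiring_norm(85) order_refl)
    show "Max S \<le> h" using that ex by (metis Suc_eq_plus1 not_less_eq_eq numeral_eq_one_iff semiring_norm(85) order_refl)
  qed
  have free: "free_point (take k (prefixes p)) (prefixes p ! k) \<longleftrightarrow> branching (take k p) = 1"
    and corner: "corner_point (take k (prefixes p)) (prefixes p ! k) \<longleftrightarrow> branching (take k p) = 2"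
    if "k \<le> length p" for k
    using that by (simp_all add: take_prefixes_proper nth_prefixes free_point_iff corner_point_iff)
  have "f = (THE f. ?P f)"
  proof -
    have "(1 \<le> f \<and> f \<le> length (prefixes p) - 1 \<and>
              (\<forall>k. 1 \<le> k \<and> k \<le> f \<longrightarrow> free_point (take k (prefixes p)) (prefixes p ! k)) \<and>
              (\<forall>k. f + 1 \<le> k \<and> k \<le> length (prefixes p) - 1 \<longrightarrow>
                corner_point (take k (prefixes p)) (prefixes p ! k))) \<longleftrightarrow> ?P f" for f
      using free corner by auto
    then show ?thesis using assms(1) by (simp add: f_def freeness_index_def)
  qed
  also have "\<dots> = Max S" using ex unique by (rule the_equality)
  finally show ?thesis using ex by simp
qed

section \<open>The Puiseux pair of a word in the directions \<open>Slope 0\<close> and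
  \<open>Vertical\<close>\<close>

lemma derived_sequence_prefixes: "derived_sequence (prefixes (d # p)) = prefixes p"
  by (simp add: derived_sequence_def comp_def)

text \<open>For words in \<open>Slope 0\<close> and \<open>Vertical\<close>, these are the orders of
  x and y on a curve along which both coordinates at the end of the word have order 1. The slope c
  is ignored, so the meaning is lost for nonzero c.\<close>

fun monomial_orders :: "inpoint \<Rightarrow> nat \<times> nat" where
  "monomial_orders [] = (1, 1)"
| "monomial_orders (Slope c # p) = (fst (monomial_orders p), fst (monomial_orders p) + snd (monomial_orders p))"
| "monomial_orders (Vertical # p) = (fst (monomial_orders p) + snd (monomial_orders p), snd (monomial_orders p))"

text \<open>Points of such a word are free as long as the first letter is repeated, and corners from
  the first change of letter on.\<close>

lemma freeness_index_word:
  assumes "set (d # p) \<subseteq> {Slope 0, Vertical}"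
  shows "2 \<le> freeness_index (prefixes (d # p)) \<longleftrightarrow> p \<noteq> [] \<and> hd p = d"
proof -
  let ?w = "d # p"
  let ?f = "freeness_index (prefixes ?w)"
  have br: "branching (take k ?w) = (if set (take k ?w) \<subseteq> {Slope 0} \<or> set (take k ?w) \<subseteq> {Vertical} then 1 else 2)"
    if "1 \<le> k" for k
  proof (rule branching_word)
    show "set (take k ?w) \<subseteq> {Slope 0, Vertical}" using order_trans[OF set_take_subset assms] .
    show "take k ?w \<noteq> []" using that by simp
  qed
  have "branching (take (k - 1) ?w) \<le> branching (take k ?w)" if "2 \<le> k" for k
  proof -
    have "set (take (k - 1) ?w) \<subseteq> set (take k ?w)" by (rule set_take_subset_set_take) simp
    then show ?thesis using br[of k] br[of "k - 1"] that by auto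
  qed
  then have f: "1 \<le> ?f \<and> ?f \<le> length ?w \<and> (\<forall>k. 1 \<le> k \<and> k \<le> ?f \<longrightarrow> branching (take k ?w) = 1) \<and>
    (\<forall>k. ?f + 1 \<le> k \<and> k \<le> length ?w \<longrightarrow> branching (take k ?w) = 2)"
    by (intro freeness_index_prefixes) auto
  show ?thesis
  proof (cases p)
    case Nil
    then show ?thesis using f by simp
  next
    case (Cons d' q)
    have "branching (take 2 ?w) = 1 \<longleftrightarrow> d' = d"
      using br[of 2] assms Cons by auto
    moreover have "2 \<le> ?f \<longleftrightarrow> branching (take 2 ?w) = 1"
    proof
      assume "2 \<le> ?f"
      then show "branching (take 2 ?w) = 1" using f by force
    next
      assume "branching (take 2 ?w) = 1"
      moreover have "2 \<le> length ?w" using Cons by simp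
      ultimately show "2 \<le> ?f" using f
        by (metis numeral_eq_one_iff semiring_norm(85) not_less_eq_eq Suc_eq_plus1)
    qed
    ultimately show ?thesis using Cons by simp
  qed
qed

text \<open>\<open>puiseux_pair\<close> puts the smaller order first, \<open>monomial_orders\<close>
  that of x, and an initial \<open>Vertical\<close> makes y the one of smaller order. The swap is
  part of the induction because the tail of a word starting with \<open>Slope 0\<close> may start
  with \<open>Vertical\<close>.\<close>

lemma puiseux_pair_word:
  assumes "set p \<subseteq> {Slope 0, Vertical}"
  shows "puiseux_pair (prefixes p) =
    (if p \<noteq> [] \<and> hd p = Vertical then prod.swap (monomial_orders p) else monomial_orders p)"
  using assms
proof (induction p)
  case Nil
  show ?case by (simp add: puiseux_pair.simps)
next
  case (Cons d p)
  have step: "puiseux_pair (prefixes (d # p)) =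
      (let (a, b) = puiseux_pair (prefixes p)
       in if p \<noteq> [] \<and> hd p = d then (a, b + a) else (b, a + b))"
    unfolding puiseux_pair.simps[of "prefixes (d # p)"] derived_sequence_prefixes
      freeness_index_word[OF Cons.prems] by simp
  obtain a b where ab: "monomial_orders p = (a, b)" by fastforce
  have "d = Slope 0 \<or> d = Vertical" "p \<noteq> [] \<longrightarrow> hd p = Slope 0 \<or> hd p = Vertical"
    using Cons.prems by (auto simp: neq_Nil_conv)
  then show ?case unfolding step using Cons ab by (cases "p = []") auto
qed

lemma monomial_orders_coprime:
  "coprime (fst (monomial_orders p)) (snd (monomial_orders p)) \<and>
    0 < fst (monomial_orders p) \<and> 0 < snd (monomial_orders p)"
proof (induction p rule: monomial_orders.induct)
  case (2 c p)
  then show ?case by (auto simp: coprime_iff_gcd_eq_1 gcd.commute)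
next
  case (3 p)
  then show ?case by (auto simp: coprime_iff_gcd_eq_1)
qed simp

lemma monomial_orders_Slope: "set p \<subseteq> {Slope 0} \<Longrightarrow> fst (monomial_orders p) = 1"
  by (induction p) (auto simp: case_prod_unfold)

lemma blow_down_word_orders:
  assumes "set p \<subseteq> {Slope 0, Vertical}" "fst \<psi> \<noteq> 0" "snd \<psi> \<noteq> 0"
    "subdegree (fst \<psi>) = 1" "subdegree (snd \<psi>) = 1"
  shows "fst (blow_down_path p \<psi>) \<noteq> 0 \<and> snd (blow_down_path p \<psi>) \<noteq> 0 \<and>
    subdegree (fst (blow_down_path p \<psi>)) = fst (monomial_orders p) \<and>
    subdegree (snd (blow_down_path p \<psi>)) = snd (monomial_orders p)"
  using assms(1)
proof (induction p)
  case (Cons d p)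
  obtain u v where uv: "blow_down_path p \<psi> = (u, v)" by fastforce
  have "d = Slope 0 \<or> d = Vertical" using Cons.prems by simp
  then show ?case using Cons uv by (auto simp: case_prod_unfold)
qed (use assms in simp)

section \<open>Centres of a cuspidal sequence and the orders of x and y on its cusps\<close>

lemma cuspidal_centre_lengths:
  assumes "cuspidal cs" "k < length cs"
  shows "length (cs ! k) = k \<and> (0 < k \<longrightarrow> (\<exists>d. cs ! k = cs ! (k - 1) @ [d]))"
  using assms(2)
proof (induction k rule: less_induct)
  case (less k)
  have seq: "cs ! k \<in> exceptional_points (take k cs)"
    using assms(1) less.prems by (simp add: cuspidal_def blowup_sequence_def)
  show ?case
  proof (cases "k = 0")
    case True
    then have "\<not> strict_prefix [] (cs ! 0)" using seq by (auto simp: exceptional_points_def)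
    then show ?thesis using True by (cases "cs ! 0") auto
  next
    case False
    then have "cs ! k \<in> divisor (take k cs) k"
      using assms(1) less.prems by (simp add: cuspidal_def)
    then obtain d q where dq: "cs ! k = cs ! (k - 1) @ d # q"
      using False by (auto simp: divisor_def)
    have "q = []"
    proof (rule ccontr)
      assume "q \<noteq> []"
      then have "strict_prefix (cs ! (k - 1) @ [d]) (cs ! k)"
        unfolding dq by (auto simp: strict_prefix_def prefix_def)
      then have "cs ! (k - 1) @ [d] \<in> set (take k cs)" using seq by (simp add: exceptional_points_def)
      then obtain j where j: "j < k" "j < length cs" "cs ! j = cs ! (k - 1) @ [d]"
        by (auto simp: in_set_conv_nth)
      \<comment> \<open>The intermediate point would be an earlier centre of length k, whereas by
        induction a centre of index j < k has length j.\<close>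
      then have "j = length (cs ! (k - 1)) + 1" using less.IH[of j] by (metis One_nat_def length_append_singleton Suc_eq_plus1)
      then show False using j(1) less.IH[of "k - 1"] less.prems False by simp
    qed
    then show ?thesis using dq less.IH[of "k - 1"] less.prems False by auto
  qed
qed

text \<open>Each centre extends the previous one by one direction, so the last centre encodes the
  whole sequence, which can be treated as a word from here on.\<close>

lemma cuspidal_prefixes:
  assumes "cuspidal cs"
  shows "cs = prefixes (last cs)"
proof -
  have ne: "cs \<noteq> []" using assms by (simp add: cuspidal_def blowup_sequence_def)
  have "cs ! j = take j (cs ! k)" if "j \<le> k" "k < length cs" for j k
    using that
  proof (induction k rule: dec_induct)
    case base
    then show ?case using cuspidal_centre_lengths[OF assms] by simp
  next
    case (step k)
    then obtain d where "cs ! Suc k = cs ! k @ [d]" "length (cs ! k) = k"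
      using cuspidal_centre_lengths[OF assms, of "Suc k"] cuspidal_centre_lengths[OF assms, of k] by auto
    then show ?case using step by simp
  qed
  moreover have last: "last cs = cs ! (length cs - 1)" using ne by (simp add: last_conv_nth)
  moreover have "length (last cs) = length cs - 1"
    using cuspidal_centre_lengths[OF assms, of "length cs - 1"] ne last by simp
  ultimately show ?thesis
    using ne by (intro nth_equalityI[of cs]) (simp_all add: nth_prefixes)
qed

lemma last_divisor_point:
  assumes "cuspidal cs" "p \<in> divisor cs (length cs)"
  obtains d where "p = last cs @ [d]"
proof -
  have ne: "cs \<noteq> []" using assms(1) by (simp add: cuspidal_def blowup_sequence_def)
  have last: "last cs = cs ! (length cs - 1)" using ne by (simp add: last_conv_nth)
  have len: "length (last cs) = length cs - 1"
    using cuspidal_centre_lengths[OF assms(1), of "length cs - 1"] ne last by simp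
  obtain d q where dq: "p = last cs @ d # q" using assms(2) last by (auto simp: divisor_def)
  have "q = []"
  proof (rule ccontr)
    assume "q \<noteq> []"
    then have "strict_prefix (last cs @ [d]) p" unfolding dq by (auto simp: strict_prefix_def prefix_def)
    then have "last cs @ [d] \<in> set cs" using assms(2) by (auto simp: divisor_def exceptional_points_def)
    then obtain j where "j < length cs" "cs ! j = last cs @ [d]" by (auto simp: in_set_conv_nth)
    then have "j = length (last cs) + 1"
      using cuspidal_centre_lengths[OF assms(1), of j] by (metis length_append_singleton Suc_eq_plus1)
    then show False using len \<open>j < length cs\<close> ne by simp
  qed
  then show ?thesis using that dq by simp
qed

text \<open>
  In adapted coordinates every centre of a cuspidal sequence with \<open>n \<ge> 2\<close> is the origin of its
  chart, so \<open>x\<close> and \<open>y\<close> are monomials there.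
\<close>

lemma cuspidal_word:
  assumes "cuspidal cs" "adapted_coordinates cs" "2 \<le> length cs"
  shows "last cs \<noteq> []" "hd (last cs) = Slope 0" "set (last cs) \<subseteq> {Slope 0, Vertical}"
proof -
  define w where "w = last cs"
  have cs: "cs = prefixes w" using cuspidal_prefixes[OF assms(1)] w_def by simp
  then have lw: "length cs = length w + 1" by simp
  have w: "w \<noteq> []" using assms(3) lw by auto
  let ?f = "freeness_index (prefixes w)"
  have e: "e_number (take k cs) (cs ! k) = branching (take k w)" if "k \<le> length w" for k
    unfolding cs using that
    by (simp add: take_prefixes_proper nth_prefixes e_number_eq)
  have "branching (take (k - 1) w) \<le> branching (take k w)" if "2 \<le> k" "k \<le> length w" for k
    using assms(1) that lw e[of k] e[of "k - 1"] unfolding cuspidal_def by (metis add_diff_cancel_right' diff_le_self le_trans)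
  then have f: "1 \<le> ?f \<and> ?f \<le> length w \<and> (\<forall>k. 1 \<le> k \<and> k \<le> ?f \<longrightarrow> branching (take k w) = 1) \<and>
    (\<forall>k. ?f + 1 \<le> k \<and> k \<le> length w \<longrightarrow> branching (take k w) = 2)"
    by (intro freeness_index_prefixes w) auto
  have "infinitely_near_point_of (cs ! ?f) (fps_X, 0)"
    using assms(2) f cs by (simp add: adapted_coordinates_def)
  then have slope: "set (take ?f w) \<subseteq> {Slope 0}"
    using f cs by (simp add: nth_prefixes infinitely_near_x_axis)
  have "hd w \<in> set (take ?f w)" using f w by (cases w; cases ?f) auto
  then show "hd (last cs) = Slope 0" using slope w_def by auto
  show "last cs \<noteq> []" using w w_def by simp
  have "w ! k \<in> {Slope 0, Vertical}" if "k < length w" for k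
  proof (cases "k < ?f")
    case True
    then have "w ! k \<in> set (take ?f w)" using that by (auto simp: in_set_conv_nth)
    then show ?thesis using slope by auto
  next
    case False
    \<comment> \<open>Beyond the index of freeness all centres are corners, and a point in a
      direction \<open>Slope c\<close> with nonzero c is always free.\<close>
    then have "branching (take (Suc k) w) = 2" using f that by simp
    then have "branching (take k w @ [w ! k]) = 2" using that by (simp add: take_Suc_conv_app_nth)
    then show ?thesis by (cases "w ! k") (auto simp: branching_snoc split: if_splits)
  qed
  then have "set w \<subseteq> {Slope 0, Vertical}" by (metis in_set_conv_nth subsetI)
  then show "set (last cs) \<subseteq> {Slope 0, Vertical}" using w_def by simp
qed

text \<open>A free point of E lies in a direction \<open>Slope c\<close> with c nonzero:
  \<open>Vertical\<close> is free only after a word of \<open>Vertical\<close> letters, and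
  \<open>Slope 0\<close> only after a word of \<open>Slope 0\<close> letters, for which n = 1. The
  coordinates u and u (v + c) at the last centre then both have order 1 on the cusp.\<close>

lemma E_cusp_orders:
  assumes cusp: "cuspidal cs" "adapted_coordinates cs" "puiseux_pair cs = (n, m)" "2 \<le> n"
    and C: "E_cusp_through cs p \<phi>"
  shows "cusp_orders n m \<phi>"
proof -
  have "\<not> length cs \<le> 1"
  proof
    assume "length cs \<le> 1"
    then have "puiseux_pair cs = (1, 1)" by (simp add: puiseux_pair.simps)
    then show False using cusp by simp
  qed
  define w where "w = last cs"
  have w: "w \<noteq> []" "hd w = Slope 0" "set w \<subseteq> {Slope 0, Vertical}"
    using cuspidal_word[OF cusp(1,2)] \<open>\<not> length cs \<le> 1\<close> w_def by auto
  have cs: "cs = prefixes w" using cuspidal_prefixes[OF cusp(1)] w_def by simp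
  have nm: "monomial_orders w = (n, m)"
    using puiseux_pair_word[OF w(3)] cusp(3) cs w by simp
  obtain w' where w': "w = Slope 0 # w'" using w by (cases w) auto
  have "n < m" using nm monomial_orders_coprime[of w'] w' by (auto simp: case_prod_unfold)
  obtain d where d: "p = w @ [d]"
    using last_divisor_point[OF cusp(1)] C w_def by (auto simp: E_cusp_through_def)
  have "free_point (proper_prefixes p) p"
    using C d cs proper_prefixes_snoc by (simp add: E_cusp_through_def)
  then have br: "branching (w @ [d]) = 1" using free_point_iff d by simp
  obtain c where c: "d = Slope c" "c \<noteq> 0"
  proof (cases d)
    case (Slope c)
    have "c \<noteq> 0"
    proof
      assume "c = 0"
      then have "card (V_divisors w) = 0" using br Slope by (simp add: branching_snoc)
      then have "set w \<subseteq> {Slope 0}" using card_V_divisors[OF w(3)] by (auto split: if_splits)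
      then show False using monomial_orders_Slope[of w] nm cusp(4) by simp
    qed
    then show ?thesis using that Slope by simp
  next
    case Vertical
    then have "set w \<subseteq> {Vertical}" using br by (auto simp: branching_snoc card_U_divisors split: if_splits)
    then show ?thesis using w' by simp
  qed
  obtain \<psi> where \<psi>: "strict_transform_at p \<phi> \<psi>" "transversal_params \<psi> (exceptional_param (last p))"
    using C by (auto simp: E_cusp_through_def)
  obtain u v where uv: "\<psi> = (u, v)" by fastforce
  \<comment> \<open>Near p the divisor E is u = 0, so transversality to E means that u has order
    1.\<close>
  have u: "fps_nth u 1 \<noteq> 0" "fps_nth u 0 = 0" "fps_nth v 0 = 0"
    using \<psi> uv c d by (auto simp: transversal_params_def velocity_def strict_transform_at_def centred_def)
  then have u1: "subdegree u = 1" "u \<noteq> 0" by (auto intro: subdegreeI)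
  have "fps_nth (v + fps_const c) 0 \<noteq> 0" using u c by simp
  then have v: "subdegree (v + fps_const c) = 0" "v + fps_const c \<noteq> 0"
    by (simp add: subdegree_eq_0_iff, metis fps_zero_nth)
  have "\<phi> = blow_down_path w (u, u * (v + fps_const c))"
    using \<psi>(1) d c uv by (simp add: strict_transform_at_def blow_down_path_append)
  then have "subdegree (fst \<phi>) = n \<and> subdegree (snd \<phi>) = m"
    using blow_down_word_orders[OF w(3), of "(u, u * (v + fps_const c))"] u1 v nm by simp
  moreover have "coprime n m" using monomial_orders_coprime[of w] nm by simp
  ultimately show ?thesis using \<open>n < m\<close> cusp(4) by unfold_locales auto
qed

theorem theorem1p1:
  fixes cs :: "inpoint list" and n m :: nat
    and C D :: param and lam :: "int \<Rightarrow> nat" and s i :: int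
    and \<omega> :: "int \<Rightarrow> form" and P :: inpoint
  assumes "cuspidal cs"
    and "puiseux_pair cs = (n, m)" and "n \<ge> 2"
    and "adapted_coordinates cs"
    and "E_cusp cs C"
    and "semimodule_basis n m (diff_values C) lam s"
    and "extended_standard_basis n m C lam s \<omega>"
    and "1 \<le> i" and "i \<le> s + 1"
    and "P \<in> divisor cs (length cs)" and "free_point cs P"
    and "analytic_semiroot cs (\<omega> i) P D"
  shows "diff_values D = Lambda_upto n m lam (i - 1)
    \<and> extended_standard_basis n m D lam (i - 1) \<omega>"
proof -
  obtain Q where "E_cusp_through cs Q C" using assms(5) unfolding E_cusp_def ..
  then have C: "cusp_orders n m C" by (rule E_cusp_orders[OF assms(1,4,2,3)])
  have "E_cusp_through cs P D" using assms(12) by (simp add: analytic_semiroot_def)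
  then have D: "cusp_orders n m D" by (rule E_cusp_orders[OF assms(1,4,2,3)])
  have inv: "diff_value D (\<omega> i) = \<infinity>" using assms(12) by (simp add: analytic_semiroot_def)
  note ext = assms(7)[unfolded extended_standard_basis_def]
  have forms: "\<forall>j\<in>{-1..s}. diff_value C (\<omega> j) = enat (lam j)"
    and dx: "\<omega> (-1) = form_dx" and dy: "\<omega> 0 = form_dy"
    and last: "nu_E_form n m (\<omega> (s + 1)) = enat (critical_order n m lam (s + 1))"
      "diff_value C (\<omega> (s + 1)) = \<infinity>"
    using ext by simp_all
  note main = invariant_cusp_values[OF C D assms(6) forms dx dy last assms(8,9) inv]
  have eq: "diff_values D = Lambda_upto n m lam (i - 1)"
    and val: "\<forall>j\<in>{-1..i - 1}. diff_value D (\<omega> j) = enat (lam j)"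
    and w: "nu_E_form n m (\<omega> i) = enat (critical_order n m lam i)"
    using main by simp_all
  have "strict_mono_on {-1..i - 1} lam"
    using assms(6,9) by (auto simp: semimodule_basis_def strict_mono_on_def)
  then have "semimodule_basis n m (diff_values D) lam (i - 1)"
    using eq assms(6,8,9) by (auto simp: semimodule_basis_def)
  then have "extended_standard_basis n m D lam (i - 1) \<omega>"
    using ext val w inv assms(8,9) by (simp add: extended_standard_basis_def)
  then show ?thesis using eq by simp
qed

end
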